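(* For every integer $k\ge0$, $$\frac{\eta(8z)^{4k}}{\eta(4z)^{2k}}\in M_k(8,\chi),\qquad\text{where }\chi(n)=\left(\frac{(-1)^k}{n}\right).$$
   Context: $\eta(z)=q^{1/24}\prod_{n\ge1}(1-q^n)$ with $q=e^{2\pi i z}$, for $z$ in the upper half plane. $\Gamma_0(N)$ and $\Gamma_1(N)$ are the groups of matrices in $\mathrm{SL}_2(\mathbb Z)$ congruent modulo $N$ to $\begin{pmatrix}*&*\\0&*\end{pmatrix}$ and $\begin{pmatrix}1&*\\0&1\end{pmatrix}$ respectively. For a Dirichlet character $\chi$ modulo $N$, $M_k(N,\chi)$ is the space of (holomorphic) modular forms $f$ of weight $k$ for $\Gamma_1(N)$ with $(cz+d)^{-k}f\left(\frac{az+b}{cz+d}\right)=\chi(d)f(z)$ for all $\begin{pmatrix}a&b\\c&d\end{pmatrix}\in\Gamma_0(N)$. Here $\chi$ is regarded as a Dirichlet character modulo $8$: it is the trivial character if $k$ is even, and $n\mapsto\left(\frac{-1}{n}\right)$ (equal to $1$ for $n\equiv1$ and $-1$ for $n\equiv3\pmod 4$) if $k$ is odd. *)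

theory Defs
  imports "HOL-Complex_Analysis.Complex_Analysis" "HOL-Number_Theory.Cong"
begin

definition upper_half_plane :: "complex set" where
  "upper_half_plane = {z. Im z > 0}"

text \<open>The factor \<open>q^(1/24)\<close> of the eta function is \<open>exp (2 \<pi> i z / 24)\<close>; the product over \<open>n \<ge> 1\<close> is shifted to start at 0.\<close>

definition dedekind_eta :: "complex \<Rightarrow> complex" where
  "dedekind_eta z =
     exp (2 * of_real pi * \<i> * z / 24) * (\<Prod>n. 1 - exp (2 * of_real pi * \<i> * z) ^ Suc n)"

definition SL2Z :: "(int ^ 2 ^ 2) set" where
  "SL2Z = {A. det A = 1}"

definition Gamma0 :: "nat \<Rightarrow> (int ^ 2 ^ 2) set" where
  "Gamma0 N = {A \<in> SL2Z. [A $ 2 $ 1 = 0] (mod int N)}"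

definition Gamma1 :: "nat \<Rightarrow> (int ^ 2 ^ 2) set" where
  "Gamma1 N = {A \<in> SL2Z. [A $ 1 $ 1 = 1] (mod int N) \<and> [A $ 2 $ 1 = 0] (mod int N) \<and>
                          [A $ 2 $ 2 = 1] (mod int N)}"

definition slash :: "int \<Rightarrow> (complex \<Rightarrow> complex) \<Rightarrow> int ^ 2 ^ 2 \<Rightarrow> complex \<Rightarrow> complex" where
  "slash k f A z =
     (of_int (A $ 2 $ 1) * z + of_int (A $ 2 $ 2)) powi (- k) *
     f ((of_int (A $ 1 $ 1) * z + of_int (A $ 1 $ 2)) / (of_int (A $ 2 $ 1) * z + of_int (A $ 2 $ 2)))"

text \<open>
  Holomorphy at the cusps: for every \<open>A\<close> in \<open>SL2Z\<close>, the function \<open>f|A\<close> has a Fourier expansion in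
  \<open>exp (2 \<pi> i z / N)\<close> with no negative powers. The period \<open>N\<close> works at every cusp, since
  conjugating the translation by \<open>N\<close> with \<open>A\<close> gives a matrix congruent to the identity modulo \<open>N\<close>.
  Values of \<open>f\<close> off the upper half plane are irrelevant.
\<close>

definition modular_forms_Gamma1 :: "int \<Rightarrow> nat \<Rightarrow> (complex \<Rightarrow> complex) set" where
  "modular_forms_Gamma1 k N = {f.
     f holomorphic_on upper_half_plane \<and>
     (\<forall>A \<in> Gamma1 N. \<forall>z \<in> upper_half_plane. slash k f A z = f z) \<and>
     (\<forall>A \<in> SL2Z. \<exists>a :: nat \<Rightarrow> complex. \<forall>z \<in> upper_half_plane.
        (\<lambda>n. a n * exp (2 * of_real pi * \<i> * z / of_nat N) ^ n) sums slash k f A z)}"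

definition dirichlet_character :: "nat \<Rightarrow> (int \<Rightarrow> complex) \<Rightarrow> bool" where
  "dirichlet_character N \<psi> \<longleftrightarrow>
     (\<forall>m n. \<psi> (m * n) = \<psi> m * \<psi> n) \<and>
     (\<forall>n. \<psi> (n + int N) = \<psi> n) \<and>
     (\<forall>n. \<psi> n = 0 \<longleftrightarrow> \<not> coprime n (int N))"

text \<open>Meaningful for \<open>\<psi>\<close> with \<open>dirichlet_character N \<psi>\<close>.\<close>

definition modular_forms :: "int \<Rightarrow> nat \<Rightarrow> (int \<Rightarrow> complex) \<Rightarrow> (complex \<Rightarrow> complex) set" where
  "modular_forms k N \<psi> = {f \<in> modular_forms_Gamma1 k N.
     \<forall>A \<in> Gamma0 N. \<forall>z \<in> upper_half_plane. slash k f A z = \<psi> (A $ 2 $ 2) * f z}"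

text \<open>The symbol \<open>((-1)\<^sup>k / n)\<close> as a character modulo 8; both cases vanish at even \<open>n\<close>.\<close>

definition chi :: "nat \<Rightarrow> int \<Rightarrow> complex" where
  "chi k n = (if even n then 0 else if even k then 1 else if [n = 1] (mod 4) then 1 else - 1)"

lemma dirichlet_character_chi: "dirichlet_character 8 (chi k)"
proof -
  have cop: "coprime n (8::int) \<longleftrightarrow> odd n" for n :: int
  proof -
    have "coprime n (2 ^ 3 :: int) \<longleftrightarrow> coprime n 2"
      by (rule coprime_power_right_iff[THEN trans]) simp
    then show ?thesis by simp
  qed
  have m4: "n mod 4 = 1 \<or> n mod 4 = 3" if "odd n" for n :: int
    using that by presburger
  have mult: "chi k (m * n) = chi k m * chi k n" for m n
  proof (cases "even m \<or> even n")
    case True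
    then show ?thesis by (auto simp: chi_def)
  next
    case False
    have "(m * n) mod 4 = ((m mod 4) * (n mod 4)) mod 4" by (simp add: mod_mult_eq)
    then show ?thesis using False m4[of m] m4[of n] by (auto simp: chi_def cong_def)
  qed
  have per: "chi k (n + 8) = chi k n" for n
  proof -
    have "(n + 8) mod 4 = n mod 4" by presburger
    then show ?thesis by (simp add: chi_def cong_def)
  qed
  show ?thesis
    unfolding dirichlet_character_def using mult per cop by (auto simp: chi_def)
qed

end

theory Submission
  imports Defs
begin

text \<open>
  For \<open>k = 1\<close> the eta quotient is \<open>\<theta>\<^sub>2(4 z)\<^sup>2 / 4\<close>, and the general case is its \<open>k\<close>-th power. The squares of
  the three theta constants are permuted up to powers of \<open>\<i>\<close> by \<open>\<tau> \<mapsto> \<tau> + 1\<close> (clear from their products) and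
  by \<open>\<tau> \<mapsto> - 1 / \<tau>\<close>. For the latter, the theta functions in \<open>z\<close> for \<open>\<tau>\<close> and \<open>- 1 / \<tau>\<close>, defined by their
  products, have the same zeros and quasi-periods after rescaling, so Liouville's theorem makes them
  proportional; comparing them at \<open>0\<close> and at the three half periods determines the factor. Euclidean
  descent on the bottom row then gives an explicit multiplier of \<open>\<theta>\<^sub>2\<^sup>2\<close> under all of \<open>SL\<^sub>2(\<int>)\<close>, from which
  both the character on \<open>\<Gamma>\<^sub>0(8)\<close> and the expansions at the cusps are read off.
\<close>

subsection \<open>Infinite products\<close>

text \<open>The infinite q-Pochhammer symbol, with factors indexed from 0, so that the Euler product
  of eta is \<open>qpoch q q\<close>.\<close>

definition qpoch :: "complex \<Rightarrow> complex \<Rightarrow> complex" where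
  "qpoch w q = (\<Prod>n. 1 - w * q ^ n)"

lemma convergent_prod_qpoch:
  fixes q w :: complex
  assumes "norm q < 1"
  shows "convergent_prod (\<lambda>n. 1 - w * q ^ n)"
proof (rule abs_convergent_prod_imp_convergent_prod, rule summable_imp_abs_convergent_prod)
  have "summable (\<lambda>n. norm w * norm q ^ n)"
    using assms by (intro summable_mult summable_geometric) auto
  then show "summable (\<lambda>n. norm (1 - w * q ^ n - 1))"
    by (simp add: norm_mult norm_power)
qed

lemma qpoch_LIMSEQ:
  assumes "norm q < 1"
  shows "(\<lambda>n. \<Prod>k<n. 1 - w * q ^ k) \<longlonglongrightarrow> qpoch w q"
  using convergent_prod_LIMSEQ[OF convergent_prod_qpoch[OF assms, of w]]
  by (simp add: qpoch_def LIMSEQ_lessThan_iff_atMost)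

lemma qpoch_nonzero:
  assumes "norm q < 1" "\<And>n. w * q ^ n \<noteq> 1"
  shows "qpoch w q \<noteq> 0"
  unfolding qpoch_def using convergent_prod_qpoch[OF assms(1)]
  by (rule prodinf_nonzero) (use assms(2) in \<open>metis eq_iff_diff_eq_0\<close>)

lemma qpoch_self_nonzero:
  assumes "norm q < 1" shows "qpoch q q \<noteq> 0"
proof (rule qpoch_nonzero[OF assms])
  fix n
  have "norm q ^ Suc n < 1"
    using assms by (subst power_less_one_iff) auto
  then have "norm (q * q ^ n) < 1"
    by (simp add: norm_mult norm_power)
  then show "q * q ^ n \<noteq> 1" by auto
qed

text \<open>Splits off the factor at index 0. This is what makes the shift of a theta argument by
  \<open>\<tau>\<close> explicit.\<close>

lemma qpoch_rec:
  assumes "norm q < 1"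
  shows "qpoch w q = (1 - w) * qpoch (q * w) q"
proof (rule LIMSEQ_unique)
  show "(\<lambda>n. \<Prod>k<Suc n. 1 - w * q ^ k) \<longlonglongrightarrow> qpoch w q"
    by (rule LIMSEQ_Suc[OF qpoch_LIMSEQ[OF assms]])
  have "(\<lambda>n. (1 - w) * (\<Prod>k<n. 1 - (q * w) * q ^ k)) \<longlonglongrightarrow> (1 - w) * qpoch (q * w) q"
    by (intro tendsto_intros qpoch_LIMSEQ assms)
  then show "(\<lambda>n. \<Prod>k<Suc n. 1 - w * q ^ k) \<longlonglongrightarrow> (1 - w) * qpoch (q * w) q"
    by (simp add: prod.lessThan_Suc_shift mult_ac del: prod.lessThan_Suc)
qed

lemma qpoch_mult_minus:
  assumes "norm q < 1"
  shows "qpoch w q * qpoch (- w) q = qpoch (w\<^sup>2) (q\<^sup>2)"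
proof -
  have "qpoch w q * qpoch (- w) q = (\<Prod>n. (1 - w * q ^ n) * (1 - (- w) * q ^ n))"
    unfolding qpoch_def by (intro prodinf_mult convergent_prod_qpoch assms)
  also have "\<dots> = qpoch (w\<^sup>2) (q\<^sup>2)"
    unfolding qpoch_def
    by (rule arg_cong[of _ _ prodinf]) (auto simp: fun_eq_iff algebra_simps power2_eq_square power_mult_distrib)
  finally show ?thesis .
qed

lemma qpoch_even_odd:
  assumes "norm q < 1"
  shows "qpoch w q = qpoch w (q\<^sup>2) * qpoch (w * q) (q\<^sup>2)"
proof (rule LIMSEQ_unique)
  have q2: "norm (q\<^sup>2) < 1"
    using assms by (simp add: norm_power power_less_one_iff abs_square_less_1)
  have "strict_mono (\<lambda>n::nat. 2 * n)" by (auto simp: strict_mono_def)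
  from LIMSEQ_subseq_LIMSEQ[OF qpoch_LIMSEQ[OF assms, of w] this]
  show "(\<lambda>n. \<Prod>k<2*n. 1 - w * q ^ k) \<longlonglongrightarrow> qpoch w q"
    by (simp add: o_def)
  have split: "(\<Prod>k<2*n. g k) = (\<Prod>k<n. g (2*k)) * (\<Prod>k<n. g (2*k+1))" for g :: "nat \<Rightarrow> complex" and n
    by (induction n) (auto simp: algebra_simps)
  have "(\<lambda>n. (\<Prod>k<n. 1 - w * (q\<^sup>2) ^ k) * (\<Prod>k<n. 1 - (w * q) * (q\<^sup>2) ^ k))
          \<longlonglongrightarrow> qpoch w (q\<^sup>2) * qpoch (w * q) (q\<^sup>2)"
    by (intro tendsto_intros qpoch_LIMSEQ q2)
  then show "(\<lambda>n. \<Prod>k<2*n. 1 - w * q ^ k) \<longlonglongrightarrow> qpoch w (q\<^sup>2) * qpoch (w * q) (q\<^sup>2)"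
    unfolding split by (simp add: power_mult mult.assoc)
qed

text \<open>Euler's identity. With \<open>q = x\<^sup>2\<close>, the first two factors merge into
  the odd part of \<open>qpoch q q\<close>. Multiplying by the even part
  \<open>qpoch (q\<^sup>2) (q\<^sup>2)\<close> and by \<open>qpoch (- q) q\<close> gives the even
  part back, and it is nonzero.\<close>

lemma qpoch_euler:
  assumes "norm x < 1"
  shows "qpoch x (x\<^sup>2) * qpoch (- x) (x\<^sup>2) * qpoch (- (x\<^sup>2)) (x\<^sup>2) = 1"
proof -
  define q where "q = x\<^sup>2"
  have q: "norm q < 1" and q2: "norm (q\<^sup>2) < 1"
    unfolding q_def using assms by (simp_all add: norm_power power_less_one_iff abs_square_less_1)
  have "qpoch x (x\<^sup>2) * qpoch (- x) (x\<^sup>2) = qpoch q (q\<^sup>2)"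
    using qpoch_mult_minus[of q x] q by (simp add: q_def)
  moreover have "qpoch q (q\<^sup>2) * qpoch (q * q) (q\<^sup>2) * qpoch (- q) q = qpoch (q\<^sup>2) (q\<^sup>2)"
    using qpoch_mult_minus[of q q] qpoch_even_odd[of q q] q by simp
  ultimately show ?thesis
    using qpoch_self_nonzero[OF q2] by (simp add: q_def power2_eq_square mult_ac)
qed

text \<open>Partial products converge uniformly on closed balls. Both parameters vary, so the M-test
  uses the maxima of \<open>norm (u z)\<close> and \<open>norm (v z)\<close> on the ball; the latter
  is attained, hence still below 1.\<close>

lemma holomorphic_on_qpoch [holomorphic_intros]:
  assumes S: "open S" and u: "u holomorphic_on S" and v: "v holomorphic_on S"
    and v1: "\<And>x. x \<in> S \<Longrightarrow> norm (v x) < 1"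
  shows "(\<lambda>x. qpoch (u x) (v x)) holomorphic_on S"
proof (rule holomorphic_uniform_sequence[OF S])
  show "(\<lambda>x. \<Prod>k<n. 1 - u x * v x ^ k) holomorphic_on S" for n
    by (intro holomorphic_intros u v)
  fix x assume "x \<in> S"
  then obtain d where d: "d > 0" and sub: "cball x d \<subseteq> S"
    using S open_contains_cball by blast
  let ?K = "cball x d"
  have cu: "continuous_on ?K u" and cv: "continuous_on ?K v"
    using u v sub by (meson continuous_on_subset holomorphic_on_imp_continuous_on)+
  have ne: "?K \<noteq> {}" using d by simp
  obtain y where y: "y \<in> ?K" and ym: "\<And>z. z \<in> ?K \<Longrightarrow> norm (v z) \<le> norm (v y)"
    using continuous_attains_sup[OF compact_cball ne continuous_on_norm[OF cv]] by blast
  obtain t where tm: "\<And>z. z \<in> ?K \<Longrightarrow> norm (u z) \<le> norm (u t)"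
    using continuous_attains_sup[OF compact_cball ne continuous_on_norm[OF cu]] by blast
  have vy: "norm (v y) < 1" using y sub v1 by auto
  have "uniformly_convergent_on ?K (\<lambda>n z. \<Prod>k<n. 1 - u z * v z ^ k)"
  proof (rule uniformly_convergent_on_prod')
    show "continuous_on ?K (\<lambda>z. 1 - u z * v z ^ n)" for n
      by (intro continuous_intros cu cv)
    show "uniformly_convergent_on ?K (\<lambda>N z. \<Sum>n<N. norm (1 - u z * v z ^ n - 1))"
    proof (rule Weierstrass_m_test')
      show "norm (norm (1 - u z * v z ^ n - 1)) \<le> norm (u t) * norm (v y) ^ n" if "z \<in> ?K" for n z
        using ym[OF that] tm[OF that] by (simp add: norm_mult norm_power mult_mono power_mono)
      show "summable (\<lambda>n. norm (u t) * norm (v y) ^ n)"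
        using vy by (intro summable_mult summable_geometric) auto
    qed
  qed auto
  then obtain l where l: "uniform_limit ?K (\<lambda>n z. \<Prod>k<n. 1 - u z * v z ^ k) l sequentially"
    by (auto simp: uniformly_convergent_on_def)
  have "l z = qpoch (u z) (v z)" if "z \<in> ?K" for z
    using tendsto_uniform_limitI[OF l that] qpoch_LIMSEQ[of "v z" "u z"] v1 sub that
    by (meson LIMSEQ_unique subsetD)
  then have "uniform_limit ?K (\<lambda>n z. \<Prod>k<n. 1 - u z * v z ^ k) (\<lambda>z. qpoch (u z) (v z)) sequentially"
    using l by (metis (mono_tags, lifting) uniform_limit_cong')
  then show "\<exists>d. 0 < d \<and> cball x d \<subseteq> S \<and>
      uniform_limit (cball x d) (\<lambda>n z. \<Prod>k<n. 1 - u z * v z ^ k) (\<lambda>z. qpoch (u z) (v z)) sequentially"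
    using d sub by blast
qed

subsection \<open>The theta product and its inversion\<close>

definition ee :: "complex \<Rightarrow> complex" where
  "ee z = exp (2 * of_real pi * \<i> * z)"

lemma ee_nonzero [simp]: "ee z \<noteq> 0"
  by (simp add: ee_def)

lemma ee_0 [simp]: "ee 0 = 1"
  by (simp add: ee_def)

lemma ee_add: "ee (x + y) = ee x * ee y"
  by (simp add: ee_def ring_distribs exp_add)

lemma ee_minus: "ee (- x) = inverse (ee x)"
  by (simp add: ee_def exp_minus)

lemma ee_diff: "ee (x - y) = ee x / ee y"
  by (simp add: ee_def right_diff_distrib exp_diff)

lemma ee_power: "ee x ^ n = ee (of_nat n * x)"
  by (simp add: ee_def exp_of_nat_mult [symmetric] mult_ac)

lemma ee_half [simp]: "ee (1/2) = - 1"
  using exp_pi_i by (simp add: ee_def mult_ac)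

lemma ee_quarter [simp]: "ee (1/4) = \<i>"
proof -
  have "2 * of_real pi * \<i> * (1/4) = \<i> * of_real (pi / 2)" by simp
  then show ?thesis by (simp only: ee_def cis_conv_exp[symmetric] cis_pi_half)
qed

lemma ee_eq_1_iff: "ee z = 1 \<longleftrightarrow> z \<in> \<int>"
proof -
  have "ee z = 1 \<longleftrightarrow> Im z = 0 \<and> (\<exists>n. Re z = of_int n)"
    by (auto simp: ee_def exp_eq_1)
  also have "\<dots> \<longleftrightarrow> z \<in> \<int>"
    by (auto simp: complex_eq_iff elim!: Ints_cases intro!: Ints_of_int)
       (metis Ints_of_int complex_eq_iff complex_Re_of_int complex_Im_of_int)
  finally show ?thesis .
qed

lemma ee_1 [simp]: "ee 1 = 1"
  by (simp add: ee_eq_1_iff)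

lemma norm_ee_less_1 [simp]: "norm (ee z) < 1 \<longleftrightarrow> Im z > 0"
  by (simp add: ee_def zero_less_mult_iff)

lemma holomorphic_on_ee [holomorphic_intros]:
  "f holomorphic_on S \<Longrightarrow> (\<lambda>z. ee (f z)) holomorphic_on S"
  unfolding ee_def by (intro holomorphic_intros)

text \<open>Jacobi's theta_1 in product form, up to a factor depending only on
  \<open>\<tau>\<close>. The factor \<open>ee (- z / 2)\<close> makes it odd in
  \<open>z\<close>.\<close>

definition theta_prod :: "complex \<Rightarrow> complex \<Rightarrow> complex" where
  "theta_prod \<tau> z = ee (- z / 2) * qpoch (ee z) (ee \<tau>) * qpoch (ee (\<tau> - z)) (ee \<tau>)"

lemma holomorphic_theta_prod:
  assumes "Im \<tau> > 0" "f holomorphic_on S" "open S"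
  shows "(\<lambda>z. theta_prod \<tau> (f z)) holomorphic_on S"
  unfolding theta_prod_def using assms by (intro holomorphic_intros) auto

context
  fixes \<tau> :: complex
  assumes \<tau>: "Im \<tau> > 0"
begin

text \<open>Isolates the factor responsible for the simple zero at 0.\<close>

lemma theta_prod_eq:
  "theta_prod \<tau> z = (1 - ee z) * (ee (- z / 2) * qpoch (ee (\<tau> + z)) (ee \<tau>) * qpoch (ee (\<tau> - z)) (ee \<tau>))"
  using qpoch_rec[of "ee \<tau>" "ee z"] \<tau> by (simp add: theta_prod_def ee_add)

lemma theta_prod_0 [simp]: "theta_prod \<tau> 0 = 0"
  by (simp add: theta_prod_eq)

lemma theta_prod_uminus: "theta_prod \<tau> (- z) = - theta_prod \<tau> z"
proof -
  have "1 - ee (- z) = - ee (- z) * (1 - ee z)"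
    by (simp add: ee_minus field_simps)
  moreover have "ee (z / 2) * ee (- z) = ee (- z / 2)"
    by (simp flip: ee_add)
  then have "ee (- z / 2) = ee (z / 2) * ee (- z)" ..
  ultimately show ?thesis
    by (simp only: theta_prod_eq minus_minus minus_divide_left) simp
qed

lemma theta_prod_plus_1: "theta_prod \<tau> (z + 1) = - theta_prod \<tau> z"
proof -
  have "ee (- (z + 1) / 2) = - ee (- z / 2)"
    using ee_diff[of "- z / 2" "1 / 2"] by (simp add: diff_divide_distrib)
  moreover have "ee (\<tau> - (z + 1)) = ee (\<tau> - z)"
    using ee_diff[of "\<tau> - z" 1] by (simp add: algebra_simps)
  ultimately show ?thesis by (simp add: theta_prod_def ee_add)
qed

text \<open>The shift multiplies \<open>ee z\<close> by \<open>ee \<tau>\<close>: one product loses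
  the factor \<open>1 - ee z\<close>, the other gains \<open>1 - ee (- z)\<close>, and these differ
  by a monomial.\<close>

lemma theta_prod_plus_tau: "theta_prod \<tau> (z + \<tau>) = - ee (- z - \<tau> / 2) * theta_prod \<tau> z"
proof -
  have 1: "qpoch (ee (- z)) (ee \<tau>) = (1 - ee (- z)) * qpoch (ee (\<tau> - z)) (ee \<tau>)"
    using qpoch_rec[of "ee \<tau>" "ee (- z)"] \<tau> by (simp flip: ee_add)
  have 2: "1 - ee (- z) = - ee (- z) * (1 - ee z)"
    by (simp add: ee_minus field_simps)
  have 3: "ee (- (z + \<tau>) / 2) * ee (- z) = ee (- z - \<tau> / 2) * ee (- z / 2)"
    unfolding ee_add[symmetric] by (rule arg_cong[of _ _ ee]) (simp add: field_simps)
  have "theta_prod \<tau> (z + \<tau>) =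
      - (ee (- (z + \<tau>) / 2) * ee (- z)) * (1 - ee z) * qpoch (ee (\<tau> + z)) (ee \<tau>) * qpoch (ee (\<tau> - z)) (ee \<tau>)"
    by (simp add: theta_prod_def 1 2 add.commute)
  then show ?thesis unfolding 3 by (simp add: theta_prod_eq)
qed

text \<open>A convergent product vanishes only if a factor does. The first product yields
  nonpositive multiples of \<open>\<tau>\<close>, the second positive ones.\<close>

lemma theta_prod_zeroD:
  assumes "theta_prod \<tau> z = 0"
  obtains m n :: int where "z = of_int m + of_int n * \<tau>"
proof -
  have "qpoch (ee z) (ee \<tau>) = 0 \<or> qpoch (ee (\<tau> - z)) (ee \<tau>) = 0"
    using assms by (auto simp: theta_prod_def)
  then obtain n where "ee z * ee \<tau> ^ n = 1 \<or> ee (\<tau> - z) * ee \<tau> ^ n = 1"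
    using qpoch_nonzero[of "ee \<tau>"] \<tau> by fastforce
  then consider "z + of_nat n * \<tau> \<in> \<int>" | "(\<tau> - z) + of_nat n * \<tau> \<in> \<int>"
    by (auto simp: ee_power ee_eq_1_iff simp flip: ee_add)
  then show thesis
  proof cases
    case 1
    then obtain m where "z + of_nat n * \<tau> = of_int m" by (auto elim: Ints_cases)
    then have "z = of_int m + of_int (- int n) * \<tau>" by (simp add: algebra_simps)
    then show ?thesis by (rule that)
  next
    case 2
    then obtain m where "(\<tau> - z) + of_nat n * \<tau> = of_int m" by (auto elim: Ints_cases)
    then have "z = of_int (- m) + of_int (int n + 1) * \<tau>" by (simp add: algebra_simps)
    then show ?thesis by (rule that)
  qed
qed

lemma theta_prod_nonzero_near_0:
  assumes "z \<noteq> 0" "norm z < min 1 (Im \<tau>)"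
  shows "theta_prod \<tau> z \<noteq> 0"
proof
  assume "theta_prod \<tau> z = 0"
  then obtain m n :: int where z: "z = of_int m + of_int n * \<tau>" by (rule theta_prod_zeroD)
  have "\<bar>of_int n\<bar> * Im \<tau> = \<bar>Im z\<bar>" using \<tau> by (simp add: z abs_mult)
  also have "\<dots> < 1 * Im \<tau>" using assms(2) abs_Im_le_cmod[of z] by simp
  finally have "\<bar>real_of_int n\<bar> < 1" using \<tau> by (simp only: mult_less_cancel_right_pos)
  then have [simp]: "n = 0" by linarith
  have "\<bar>real_of_int m\<bar> < 1" using assms(2) abs_Re_le_cmod[of z] by (simp add: z)
  then have "m = 0" by linarith
  with assms(1) z show False by simp
qed

end

section \<open>Uniqueness of the theta product by Liouville's theorem\<close>

lemma periodic_int_mult: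
  fixes a :: "'a :: comm_ring_1"
  assumes "\<And>z. f (z + a) = f z"
  shows "f (z + of_int n * a) = f z"
proof (induction n rule: int_induct[where k = 0])
  case (step1 i)
  then show ?case using assms[of "z + of_int i * a"] by (simp add: algebra_simps)
next
  case (step2 i)
  then show ?case using assms[of "z + of_int (i - 1) * a"] by (simp add: algebra_simps)
qed simp

text \<open>The quotient by \<open>theta_prod\<close> is an entire elliptic function.\<close>

lemma theta_prod_unique:
  assumes \<tau>: "Im \<tau> > 0" and F: "F holomorphic_on UNIV"
    and F1: "\<And>z. F (z + 1) = - F z"
    and F\<tau>: "\<And>z. F (z + \<tau>) = - ee (- z - \<tau> / 2) * F z"
    and lim: "((\<lambda>z. F z / theta_prod \<tau> z) \<longlongrightarrow> c) (at 0)"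
    and z: "theta_prod \<tau> z \<noteq> 0"
  shows "F z = c * theta_prod \<tau> z"
proof -
  let ?\<phi> = "theta_prod \<tau>"
  \<comment> \<open>The limit \<open>c\<close> at 0 is also the right value at all other zeros of
    the denominator, since these are lattice points and the quotient is periodic.\<close>
  define H where "H = (\<lambda>z. if ?\<phi> z = 0 then c else F z / ?\<phi> z)"
  have hol\<phi>: "?\<phi> holomorphic_on UNIV"
    using holomorphic_theta_prod[OF \<tau>, of "\<lambda>z. z" UNIV] by simp
  have "H (z + 1) = H z" "H (z + \<tau>) = H z" for z
    by (auto simp: H_def theta_prod_plus_1[OF \<tau>] theta_prod_plus_tau[OF \<tau>] F1 F\<tau>)
  then have per: "H (z + (of_int m + of_int n * \<tau>)) = H z" for m n z
    using periodic_int_mult[of H 1 "z + of_int n * \<tau>" m] periodic_int_mult[of H \<tau> z n]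
    by (simp add: add_ac)
  define r where "r = min 1 (Im \<tau>)"
  have r: "r > 0" using \<tau> by (simp add: r_def)
  have nz: "?\<phi> z \<noteq> 0" if "z \<in> ball 0 r - {0}" for z
    using that theta_prod_nonzero_near_0[OF \<tau>] by (simp add: r_def)
  have "H holomorphic_on ball 0 r"
  proof (rule no_isolated_singularity')
    show "H holomorphic_on ball 0 r - {0}"
    proof (rule holomorphic_transform)
      show "(\<lambda>z. F z / ?\<phi> z) holomorphic_on ball 0 r - {0}"
        using nz by (intro holomorphic_on_divide holomorphic_on_subset[OF F]
            holomorphic_on_subset[OF hol\<phi>]) auto
    qed (use nz in \<open>auto simp: H_def\<close>)
    show "(H \<longlongrightarrow> H y) (at y within ball 0 r)" if "y \<in> {0}" for y
    proof -
      have "\<forall>\<^sub>F z in at 0. F z / ?\<phi> z = H z"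
      proof (rule eventually_mono)
        show "\<forall>\<^sub>F z in at 0. z \<in> ball 0 r - {0}"
          using r by (intro eventually_at_in_open) auto
      qed (use nz in \<open>simp add: H_def\<close>)
      then have "(H \<longlongrightarrow> c) (at 0)" by (rule Lim_transform_eventually[OF lim])
      then have "(H \<longlongrightarrow> c) (at 0 within ball 0 r)"
        by (rule tendsto_within_subset) simp
      moreover have "H 0 = c" using \<tau> by (simp add: H_def)
      ultimately show ?thesis using that by simp
    qed
  qed auto
  then have H0: "H field_differentiable at 0"
    using r by (auto simp: holomorphic_on_open field_differentiable_def)
  have op: "open {z. ?\<phi> z \<noteq> 0}"
    using holomorphic_on_imp_continuous_on[OF hol\<phi>]
    by (intro open_Collect_neq continuous_intros)
  have "H field_differentiable at z" for z
  proof (cases "?\<phi> z = 0")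
    case True
    then obtain m n where mn: "z = of_int m + of_int n * \<tau>" by (rule theta_prod_zeroD[OF \<tau>])
    \<comment> \<open>Translation by the lattice point \<open>z\<close> carries differentiability
      from 0 to \<open>z\<close>.\<close>
    have H_eq: "H = H \<circ> (\<lambda>x. x - z)"
      using per[of "_ - z" m n] by (auto simp: fun_eq_iff mn)
    have "(H \<circ> (\<lambda>x. x - z)) field_differentiable at z"
      using H0 by (intro field_differentiable_compose derivative_intros) auto
    then show ?thesis using H_eq by metis
  next
    case False
    have "H holomorphic_on {z. ?\<phi> z \<noteq> 0}"
    proof (rule holomorphic_transform)
      show "(\<lambda>z. F z / ?\<phi> z) holomorphic_on {z. ?\<phi> z \<noteq> 0}"
        by (intro holomorphic_on_divide holomorphic_on_subset[OF F]
            holomorphic_on_subset[OF hol\<phi>]) auto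
    qed (auto simp: H_def)
    then show ?thesis using op False by (auto simp: holomorphic_on_open field_differentiable_def)
  qed
  then have holH: "H holomorphic_on UNIV"
    by (simp add: holomorphic_on_def)
  \<comment> \<open>The closed period parallelogram: by periodicity \<open>H\<close> takes all its
    values there.\<close>
  define K where "K = (\<lambda>p :: real \<times> real. of_real (fst p) + of_real (snd p) * \<tau>) ` ({0..1} \<times> {0..1})"
  have "compact K"
    unfolding K_def by (intro compact_continuous_image continuous_intros compact_Times) auto
  then have "bounded (H ` K)"
    using holH by (intro compact_imp_bounded compact_continuous_image)
       (auto intro: holomorphic_on_imp_continuous_on holomorphic_on_subset)
  moreover have "range H \<subseteq> H ` K"
  proof
    fix y assume "y \<in> range H"
    then obtain z where y: "y = H z" by auto
    define t where "t = Im z / Im \<tau>"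
    define s where "s = Re z - t * Re \<tau>"
    have zst: "z = of_real s + of_real t * \<tau>"
      using \<tau> by (simp add: complex_eq_iff s_def t_def)
    have "z + (of_int (- \<lfloor>s\<rfloor>) + of_int (- \<lfloor>t\<rfloor>) * \<tau>) = of_real (frac s) + of_real (frac t) * \<tau>"
      by (simp add: zst frac_def algebra_simps)
    then have "H z = H (of_real (frac s) + of_real (frac t) * \<tau>)"
      using per[of z "- \<lfloor>s\<rfloor>" "- \<lfloor>t\<rfloor>"] by simp
    moreover have "of_real (frac s) + of_real (frac t) * \<tau> \<in> K"
      unfolding K_def by (rule image_eqI[of _ _ "(frac s, frac t)"])
         (auto simp: frac_ge_0 frac_lt_1 less_imp_le)
    ultimately show "y \<in> H ` K" using y by auto
  qed
  ultimately have "bounded (range H)" by (rule bounded_subset)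
  then have "H constant_on UNIV" by (rule Liouville_theorem[OF holH])
  then have "H z = H 0" by (auto simp: constant_on_def)
  then show ?thesis using z \<tau> by (simp add: H_def field_simps)
qed

section \<open>Squares of the theta constants under translation and inversion\<close>

text \<open>Jacobi's products for the squared theta constants; \<open>ee \<tau>\<close> is the
  square of the classical nome.\<close>

definition theta2_sq :: "complex \<Rightarrow> complex" where
  "theta2_sq \<tau> = 4 * ee (\<tau> / 4) * qpoch (ee \<tau>) (ee \<tau>) ^ 2 * qpoch (- ee \<tau>) (ee \<tau>) ^ 4"

definition theta3_sq :: "complex \<Rightarrow> complex" where
  "theta3_sq \<tau> = qpoch (ee \<tau>) (ee \<tau>) ^ 2 * qpoch (- ee (\<tau> / 2)) (ee \<tau>) ^ 4"

definition theta4_sq :: "complex \<Rightarrow> complex" where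
  "theta4_sq \<tau> = qpoch (ee \<tau>) (ee \<tau>) ^ 2 * qpoch (ee (\<tau> / 2)) (ee \<tau>) ^ 4"

lemma ee_plus_1 [simp]: "ee (z + 1) = ee z" "ee (1 + z) = ee z"
  by (simp_all add: ee_add)

lemma ee_half_shift: "ee ((z + 1) / 2) = - ee (z / 2)"
  using ee_add[of "z / 2" "1 / 2"] by (simp add: add_divide_distrib)

lemma theta_sq_plus_1:
  "theta2_sq (\<tau> + 1) = \<i> * theta2_sq \<tau>"
  "theta3_sq (\<tau> + 1) = theta4_sq \<tau>"
  "theta4_sq (\<tau> + 1) = theta3_sq \<tau>"
proof -
  have "ee ((\<tau> + 1) / 4) = \<i> * ee (\<tau> / 4)"
    using ee_add[of "\<tau> / 4" "1 / 4"] by (simp add: add_divide_distrib)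
  then show "theta2_sq (\<tau> + 1) = \<i> * theta2_sq \<tau>"
    by (simp add: theta2_sq_def)
qed (simp_all add: theta3_sq_def theta4_sq_def ee_half_shift)

text \<open>Links the function of \<open>z\<close> to the theta constants: up to elementary factors,
  the values are the squares of the products in \<open>theta2_sq\<close>, \<open>theta4_sq\<close>
  and \<open>theta3_sq\<close>, in this order.\<close>

lemma theta_prod_half_periods:
  assumes "Im \<tau> > 0"
  shows "theta_prod \<tau> (1/2) = - 2 * \<i> * qpoch (- ee \<tau>) (ee \<tau>) ^ 2"
    and "theta_prod \<tau> (\<tau>/2) = ee (- \<tau> / 4) * qpoch (ee (\<tau>/2)) (ee \<tau>) ^ 2"
    and "theta_prod \<tau> (1/2 + \<tau>/2) = - \<i> * ee (- \<tau> / 4) * qpoch (- ee (\<tau>/2)) (ee \<tau>) ^ 2"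
proof -
  have m4: "ee (- (1/4)) = - \<i>" by (simp add: ee_minus)
  have h: "ee (1/2 + z) = - ee z" "ee (z - 1/2) = - ee z" for z
    by (simp_all add: ee_add ee_diff)
  show "theta_prod \<tau> (1/2) = - 2 * \<i> * qpoch (- ee \<tau>) (ee \<tau>) ^ 2"
    using m4 qpoch_rec[of "ee \<tau>" "- 1"] assms by (simp add: theta_prod_def h power2_eq_square)
  have t: "\<tau> - \<tau> / 2 = \<tau> / 2" by simp
  show "theta_prod \<tau> (\<tau>/2) = ee (- \<tau> / 4) * qpoch (ee (\<tau>/2)) (ee \<tau>) ^ 2"
    by (simp add: theta_prod_def t power2_eq_square)
  have e1: "ee (- (1/2 + \<tau>/2) / 2) = - \<i> * ee (- \<tau> / 4)"
  proof -
    have "- (1/2 + \<tau>/2) / 2 = - (1/4) + - \<tau> / 4" by (simp add: field_simps)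
    then show ?thesis by (simp only: ee_add m4)
  qed
  have e2: "ee (\<tau> - (1/2 + \<tau>/2)) = - ee (\<tau> / 2)"
  proof -
    have "\<tau> - (1/2 + \<tau>/2) = \<tau> / 2 - 1/2" by (simp add: field_simps)
    then show ?thesis by (simp only: h)
  qed
  show "theta_prod \<tau> (1/2 + \<tau>/2) = - \<i> * ee (- \<tau> / 4) * qpoch (- ee (\<tau>/2)) (ee \<tau>) ^ 2"
    unfolding theta_prod_def e1 e2 h(1) by (simp add: power2_eq_square)
qed

lemma qpoch_euler_ee:
  assumes "Im \<tau> > 0"
  shows "qpoch (- ee \<tau>) (ee \<tau>) * qpoch (ee (\<tau>/2)) (ee \<tau>) * qpoch (- ee (\<tau>/2)) (ee \<tau>) = 1"
proof -
  have "(ee (\<tau>/2))\<^sup>2 = ee \<tau>" by (simp add: ee_power)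
  then show ?thesis using qpoch_euler[of "ee (\<tau>/2)"] assms by (simp add: mult_ac)
qed

text \<open>Both theta products have a simple zero at 0. The quotient of the vanishing factors tends
  to \<open>1 / \<tau>\<close> by l'Hopital's rule, and the remaining factors are
  continuous.\<close>

lemma tendsto_theta_prod_ratio:
  assumes \<tau>: "Im \<tau> > 0" and \<tau>': "Im \<tau>' > 0" and nz: "\<tau> \<noteq> 0"
  shows "((\<lambda>z. ee (- z\<^sup>2 / (2 * \<tau>)) * theta_prod \<tau>' (z / \<tau>) / theta_prod \<tau> z)
     \<longlongrightarrow> qpoch (ee \<tau>') (ee \<tau>') ^ 2 / (\<tau> * qpoch (ee \<tau>) (ee \<tau>) ^ 2)) (at 0)"
proof -
  define R where "R = (\<lambda>\<tau> z. ee (- z / 2) * qpoch (ee (\<tau> + z)) (ee \<tau>) * qpoch (ee (\<tau> - z)) (ee \<tau>))"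
  have holR: "R \<tau> holomorphic_on UNIV" if "Im \<tau> > 0" for \<tau>
    unfolding R_def using that by (intro holomorphic_intros) auto
  have R: "((\<lambda>z. R \<tau> (z / c)) \<longlongrightarrow> qpoch (ee \<tau>) (ee \<tau>) ^ 2) (at 0)" if "Im \<tau> > 0" "c \<noteq> 0" for \<tau> c
  proof -
    have "isCont (\<lambda>z. R \<tau> (z / c)) 0"
      by (rule isCont_o2) (use that holomorphic_on_imp_continuous_on[OF holR[of \<tau>]] in
          \<open>auto simp: continuous_on_eq_continuous_at intro!: continuous_intros\<close>)
    then show ?thesis by (simp add: isCont_def R_def power2_eq_square)
  qed
  have "isCont (\<lambda>z. ee (- z\<^sup>2 / (2 * \<tau>))) 0"
    unfolding ee_def using nz by (intro continuous_intros) auto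
  then have E: "((\<lambda>z. ee (- z\<^sup>2 / (2 * \<tau>))) \<longlongrightarrow> 1) (at 0)"
    by (simp add: isCont_def)
  have L: "((\<lambda>z. (1 - ee (z / \<tau>)) / (1 - ee z)) \<longlongrightarrow> 1 / \<tau>) (at 0)"
  proof (rule lhopital_complex_simple)
    show "((\<lambda>z. 1 - ee (z / \<tau>)) has_field_derivative - (2 * of_real pi * \<i> / \<tau>)) (at 0)"
      unfolding ee_def using nz by (auto intro!: derivative_eq_intros)
    show "((\<lambda>z. 1 - ee z) has_field_derivative - (2 * of_real pi * \<i>)) (at 0)"
      unfolding ee_def by (auto intro!: derivative_eq_intros)
  qed (use nz in auto)
  have Q: "qpoch (ee \<tau>) (ee \<tau>) ^ 2 \<noteq> 0"
    using qpoch_self_nonzero[of "ee \<tau>"] \<tau> by simp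
  have "((\<lambda>z. ee (- z\<^sup>2 / (2 * \<tau>)) * ((1 - ee (z / \<tau>)) / (1 - ee z)) * (R \<tau>' (z / \<tau>) / R \<tau> (z / 1)))
      \<longlongrightarrow> 1 * (1 / \<tau>) * (qpoch (ee \<tau>') (ee \<tau>') ^ 2 / qpoch (ee \<tau>) (ee \<tau>) ^ 2)) (at 0)"
    by (intro tendsto_mult tendsto_divide E L R Q \<tau> \<tau>' nz) auto
  then show ?thesis
    by (simp add: R_def theta_prod_eq[OF \<tau>] theta_prod_eq[OF \<tau>'] mult_ac)
qed

lemma Im_neg_inverse: "Im \<tau> > 0 \<Longrightarrow> Im (- 1 / \<tau>) > 0"
  by (auto simp: Im_divide zero_less_divide_iff sum_power2_gt_zero_iff)

text \<open>Division by \<open>\<tau>\<close> turns the shifts 1 and \<open>\<tau>\<close> into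
  \<open>- \<tau>'\<close> and 1, and the Gaussian factor corrects the resulting multipliers to
  those of \<open>theta_prod \<tau>\<close>. Uniqueness applies, with the limit of the quotient at 0
  as constant.\<close>

lemma theta_prod_inversion:
  assumes \<tau>: "Im \<tau> > 0" and nz: "theta_prod \<tau> z \<noteq> 0"
  defines "\<tau>' \<equiv> - 1 / \<tau>"
  shows "ee (- z\<^sup>2 / (2 * \<tau>)) * theta_prod \<tau>' (z / \<tau>) =
    qpoch (ee \<tau>') (ee \<tau>') ^ 2 / (\<tau> * qpoch (ee \<tau>) (ee \<tau>) ^ 2) * theta_prod \<tau> z"
proof (rule theta_prod_unique[OF \<tau> _ _ _ _ nz])
  have \<tau>': "Im \<tau>' > 0" unfolding \<tau>'_def using \<tau> by (rule Im_neg_inverse)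
  have \<tau>0 [simp]: "\<tau> \<noteq> 0" using \<tau> by auto
  show "((\<lambda>z. ee (- z\<^sup>2 / (2 * \<tau>)) * theta_prod \<tau>' (z / \<tau>) / theta_prod \<tau> z)
     \<longlongrightarrow> qpoch (ee \<tau>') (ee \<tau>') ^ 2 / (\<tau> * qpoch (ee \<tau>) (ee \<tau>) ^ 2)) (at 0)"
    by (rule tendsto_theta_prod_ratio[OF \<tau> \<tau>' \<tau>0])
  show "(\<lambda>z. ee (- z\<^sup>2 / (2 * \<tau>)) * theta_prod \<tau>' (z / \<tau>)) holomorphic_on UNIV"
    by (intro holomorphic_intros holomorphic_theta_prod[OF \<tau>']) auto
  show "ee (- (z + 1)\<^sup>2 / (2 * \<tau>)) * theta_prod \<tau>' ((z + 1) / \<tau>) =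
      - (ee (- z\<^sup>2 / (2 * \<tau>)) * theta_prod \<tau>' (z / \<tau>))" for z
  proof -
    have y: "(z + 1) / \<tau> + \<tau>' = z / \<tau>" by (simp add: \<tau>'_def field_simps)
    have "theta_prod \<tau>' (z / \<tau>) = - ee (- ((z + 1) / \<tau>) - \<tau>' / 2) * theta_prod \<tau>' ((z + 1) / \<tau>)"
      using theta_prod_plus_tau[OF \<tau>', of "(z + 1) / \<tau>"] unfolding y .
    moreover have "ee (- (z + 1)\<^sup>2 / (2 * \<tau>)) = ee (- z\<^sup>2 / (2 * \<tau>)) * ee (- ((z + 1) / \<tau>) - \<tau>' / 2)"
      unfolding ee_add[symmetric]
      by (rule arg_cong[of _ _ ee]) (simp add: \<tau>'_def field_simps power2_eq_square)
    ultimately show ?thesis by simp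
  qed
  show "ee (- (z + \<tau>)\<^sup>2 / (2 * \<tau>)) * theta_prod \<tau>' ((z + \<tau>) / \<tau>) =
      - ee (- z - \<tau> / 2) * (ee (- z\<^sup>2 / (2 * \<tau>)) * theta_prod \<tau>' (z / \<tau>))" for z
  proof -
    have "(z + \<tau>) / \<tau> = z / \<tau> + 1" by (simp add: field_simps)
    moreover have "ee (- (z + \<tau>)\<^sup>2 / (2 * \<tau>)) = ee (- z - \<tau> / 2) * ee (- z\<^sup>2 / (2 * \<tau>))"
      unfolding ee_add[symmetric]
      by (rule arg_cong[of _ _ ee]) (simp add: field_simps power2_eq_square)
    ultimately show ?thesis by (simp add: theta_prod_plus_1[OF \<tau>'])
  qed
qed

text \<open>
  Comparing the values of both sides of the inversion formula at the three half periods gives three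
  relations for its constant \<open>c\<close>; their product determines \<open>c\<^sup>3\<close> because of Euler's identity.
\<close>

lemma theta_sq_inversion:
  assumes \<tau>: "Im \<tau> > 0"
  shows "theta2_sq (- 1 / \<tau>) = - \<i> * \<tau> * theta4_sq \<tau>"
    and "theta3_sq (- 1 / \<tau>) = - \<i> * \<tau> * theta3_sq \<tau>"
    and "theta4_sq (- 1 / \<tau>) = - \<i> * \<tau> * theta2_sq \<tau>"
proof -
  define \<tau>' where "\<tau>' = - 1 / \<tau>"
  have \<tau>': "Im \<tau>' > 0" unfolding \<tau>'_def using \<tau> by (rule Im_neg_inverse)
  have \<tau>0 [simp]: "\<tau> \<noteq> 0" using \<tau> by auto
  define Q Q' where "Q = qpoch (ee \<tau>) (ee \<tau>)" and "Q' = qpoch (ee \<tau>') (ee \<tau>')"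
  define A A' where "A = qpoch (- ee \<tau>) (ee \<tau>)" and "A' = qpoch (- ee \<tau>') (ee \<tau>')"
  define B B' where "B = qpoch (ee (\<tau>/2)) (ee \<tau>)" and "B' = qpoch (ee (\<tau>'/2)) (ee \<tau>')"
  define C C' where "C = qpoch (- ee (\<tau>/2)) (ee \<tau>)" and "C' = qpoch (- ee (\<tau>'/2)) (ee \<tau>')"
  define c where "c = Q'\<^sup>2 / (\<tau> * Q\<^sup>2)"
  \<comment> \<open>Up to powers of \<open>\<i>\<close>, all exponentials arising at the half
    periods are monomials in these two.\<close>
  define u v where "u = ee (\<tau> / 8)" and "v = ee (\<tau>' / 8)"
  have [simp]: "u \<noteq> 0" "v \<noteq> 0" by (simp_all add: u_def v_def)
  have u: "ee (- \<tau> / 4) = 1 / u\<^sup>2" "ee (- \<tau> / 8) = 1 / u" "ee (\<tau> / 4) = u\<^sup>2"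
    and v: "ee (- \<tau>' / 4) = 1 / v\<^sup>2" "ee (\<tau>' / 8) = v" "ee (\<tau>' / 4) = v\<^sup>2"
    by (simp_all add: u_def v_def ee_power ee_minus inverse_eq_divide)
  have ABC: "A * B * C = 1" "A' * B' * C' = 1"
    using qpoch_euler_ee[OF \<tau>] qpoch_euler_ee[OF \<tau>'] by (simp_all add: A_def B_def C_def A'_def B'_def C'_def)
  then have nz: "A \<noteq> 0" "B \<noteq> 0" "C \<noteq> 0" by auto
  have Q0: "Q \<noteq> 0" using qpoch_self_nonzero[of "ee \<tau>"] \<tau> by (simp add: Q_def)
  have Qc: "Q'\<^sup>2 = c * \<tau> * Q\<^sup>2" using Q0 by (simp add: c_def)
  note val = theta_prod_half_periods[OF \<tau>, folded A_def B_def C_def]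
  note val' = theta_prod_half_periods[OF \<tau>', folded A'_def B'_def C'_def]
  note inv = theta_prod_inversion[OF \<tau>, folded \<tau>'_def Q_def Q'_def, folded c_def]
  \<comment> \<open>Division by \<open>\<tau>\<close> sends \<open>1/2\<close> to
    \<open>- (\<tau>'/2)\<close>, \<open>\<tau>/2\<close> to \<open>1/2\<close> and their sum to
    \<open>1/2 - \<tau>'/2\<close>. Hence \<open>E1\<close> and \<open>E2\<close> exchange the roles
    of \<open>A\<close> and \<open>B\<close>, while \<open>E3\<close> keeps
    \<open>C\<close>.\<close>
  have E1: "B'\<^sup>2 = 2 * \<i> * c * v * A\<^sup>2"
  proof -
    have "ee (- (1/2)\<^sup>2 / (2 * \<tau>)) * theta_prod \<tau>' (1/2 / \<tau>) = c * theta_prod \<tau> (1/2)"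
      by (rule inv) (use val nz in simp)
    moreover have "theta_prod \<tau>' (1/2 / \<tau>) = - (B'\<^sup>2 / v\<^sup>2)"
    proof -
      have "1/2 / \<tau> = - (\<tau>' / 2)" by (simp add: \<tau>'_def)
      then show ?thesis
        by (simp only: theta_prod_uminus[OF \<tau>'] val'(2) v(1)) simp
    qed
    moreover have "ee (- (1/2)\<^sup>2 / (2 * \<tau>)) = v"
      by (simp add: v_def \<tau>'_def power2_eq_square mult.commute)
    ultimately have *: "v * - (B'\<^sup>2 / v\<^sup>2) = c * (- 2 * \<i> * A\<^sup>2)" using val(1) by simp
    have "B'\<^sup>2 = - v * (v * - (B'\<^sup>2 / v\<^sup>2))"
      by (simp add: power2_eq_square)
    also have "\<dots> = 2 * \<i> * c * v * A\<^sup>2"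
      unfolding * by simp
    finally show ?thesis .
  qed
  have E2: "2 * A'\<^sup>2 * u = \<i> * c * B\<^sup>2"
  proof -
    have "ee (- (\<tau>/2)\<^sup>2 / (2 * \<tau>)) * theta_prod \<tau>' (\<tau>/2 / \<tau>) = c * theta_prod \<tau> (\<tau>/2)"
      by (rule inv) (use val nz in simp)
    moreover have "ee (- (\<tau>/2)\<^sup>2 / (2 * \<tau>)) = 1 / u"
      unfolding u(2)[symmetric] by (rule arg_cong[of _ _ ee]) (simp add: power2_eq_square)
    moreover have "\<tau> / 2 / \<tau> = 1 / 2" by simp
    ultimately have *: "1 / u * (- 2 * \<i> * A'\<^sup>2) = c * (1 / u\<^sup>2 * B\<^sup>2)"
      by (simp only: val(2) val'(1) u(1))
    have "2 * A'\<^sup>2 * u = \<i> * u\<^sup>2 * (1 / u * (- 2 * \<i> * A'\<^sup>2))"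
      by (simp add: power2_eq_square)
    also have "\<dots> = \<i> * c * B\<^sup>2"
      unfolding * by simp
    finally show ?thesis .
  qed
  have E3: "C'\<^sup>2 * u = \<i> * c * v * C\<^sup>2"
  proof -
    have "ee (- (1/2 + \<tau>/2)\<^sup>2 / (2 * \<tau>)) * theta_prod \<tau>' ((1/2 + \<tau>/2) / \<tau>) = c * theta_prod \<tau> (1/2 + \<tau>/2)"
      by (rule inv) (use val nz in simp)
    moreover have "theta_prod \<tau>' ((1/2 + \<tau>/2) / \<tau>) = - \<i> * (C'\<^sup>2 / v\<^sup>2)"
    proof -
      \<comment> \<open>Oddness and the shift by 1 contribute one sign each.\<close>
      have "theta_prod \<tau>' (- ((1/2 + \<tau>/2) / \<tau>) + 1) = theta_prod \<tau>' ((1/2 + \<tau>/2) / \<tau>)"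
        unfolding theta_prod_plus_1[OF \<tau>'] theta_prod_uminus[OF \<tau>'] by simp
      moreover have "- ((1/2 + \<tau>/2) / \<tau>) + 1 = 1/2 + \<tau>'/2"
        by (simp add: \<tau>'_def field_simps)
      ultimately show ?thesis using val'(3) v by simp
    qed
    moreover have "ee (- (1/2 + \<tau>/2)\<^sup>2 / (2 * \<tau>)) = - \<i> * v / u"
    proof -
      have "- (1/2 + \<tau>/2)\<^sup>2 / (2 * \<tau>) = \<tau>' / 8 + - (1/4) + - \<tau> / 8"
        by (simp add: \<tau>'_def field_simps power2_eq_square)
      then show ?thesis
        by (simp only: ee_add v u ee_minus[of "1/4"] ee_quarter) simp
    qed
    ultimately have *: "- \<i> * v / u * (- \<i> * (C'\<^sup>2 / v\<^sup>2)) = c * (- \<i> * (1 / u\<^sup>2) * C\<^sup>2)"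
      by (simp only: val(3) u(1))
    have "C'\<^sup>2 * u = - (u\<^sup>2 * v) * (- \<i> * v / u * (- \<i> * (C'\<^sup>2 / v\<^sup>2)))"
      by (simp add: power2_eq_square)
    also have "\<dots> = \<i> * c * v * C\<^sup>2"
      unfolding * by simp
    finally show ?thesis .
  qed
  have c0: "c \<noteq> 0"
    using E1 ABC by auto
  have c3: "c ^ 3 * v\<^sup>2 = \<i> * u\<^sup>2"
  proof -
    have "(B'\<^sup>2) * (2 * A'\<^sup>2 * u) * (C'\<^sup>2 * u) = (2 * \<i> * c * v * A\<^sup>2) * (\<i> * c * B\<^sup>2) * (\<i> * c * v * C\<^sup>2)"
      by (simp only: E1 E2 E3)
    then have "2 * (A' * B' * C')\<^sup>2 * u\<^sup>2 = - 2 * \<i> * c ^ 3 * v\<^sup>2 * (A * B * C)\<^sup>2"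
      by (simp add: power2_eq_square power3_eq_cube mult_ac)
    then have "u\<^sup>2 = - \<i> * (c ^ 3 * v\<^sup>2)" by (simp add: ABC)
    then show ?thesis by (simp flip: mult.assoc)
  qed
  \<comment> \<open>\<open>Q'\<^sup>2\<close> contributes one factor \<open>c\<close> and the fourth
    power of \<open>B'\<close> two more, so only \<open>c ^ 3\<close> enters and no cube root has to
    be chosen.\<close>
  have "theta4_sq \<tau>' = Q'\<^sup>2 * (B'\<^sup>2)\<^sup>2"
    by (simp add: theta4_sq_def Q'_def B'_def)
  also have "\<dots> = - 4 * (c ^ 3 * v\<^sup>2) * \<tau> * Q\<^sup>2 * A ^ 4"
    unfolding Qc E1 by (simp add: power2_eq_square power3_eq_cube power4_eq_xxxx mult_ac)
  also have "\<dots> = - \<i> * \<tau> * theta2_sq \<tau>"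
    unfolding c3 by (simp add: theta2_sq_def Q_def A_def u)
  finally show "theta4_sq (- 1 / \<tau>) = - \<i> * \<tau> * theta2_sq \<tau>" by (simp only: \<tau>'_def)
  have "u\<^sup>2 * theta3_sq \<tau>' = Q'\<^sup>2 * (C'\<^sup>2 * u)\<^sup>2"
    by (simp add: theta3_sq_def Q'_def C'_def power_mult_distrib)
  also have "\<dots> = - (c ^ 3 * v\<^sup>2) * \<tau> * Q\<^sup>2 * C ^ 4"
    unfolding Qc E3 by (simp add: power2_eq_square power3_eq_cube power4_eq_xxxx mult_ac)
  also have "\<dots> = u\<^sup>2 * (- \<i> * \<tau> * theta3_sq \<tau>)"
    unfolding c3 by (simp add: theta3_sq_def Q_def C_def)
  finally show "theta3_sq (- 1 / \<tau>) = - \<i> * \<tau> * theta3_sq \<tau>"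
    unfolding \<tau>'_def by (rule mult_left_cancel[THEN iffD1, rotated]) simp
  have "u\<^sup>2 * theta2_sq \<tau>' = Q'\<^sup>2 * v\<^sup>2 * (2 * A'\<^sup>2 * u)\<^sup>2"
    by (simp add: theta2_sq_def Q'_def A'_def power_mult_distrib v)
  also have "\<dots> = - (c ^ 3 * v\<^sup>2) * \<tau> * Q\<^sup>2 * B ^ 4"
    unfolding Qc E2 by (simp add: power2_eq_square power3_eq_cube power4_eq_xxxx mult_ac)
  also have "\<dots> = u\<^sup>2 * (- \<i> * \<tau> * theta4_sq \<tau>)"
    unfolding c3 by (simp add: theta4_sq_def Q_def B_def)
  finally show "theta2_sq (- 1 / \<tau>) = - \<i> * \<tau> * theta4_sq \<tau>"
    unfolding \<tau>'_def by (rule mult_left_cancel[THEN iffD1, rotated]) simp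
qed

subsection \<open>The multiplier of the square of \<open>\<theta>\<^sub>2\<close>\<close>

lemma imaginary_powi_cong:
  assumes "[m = n] (mod 4)"
  shows "\<i> powi m = \<i> powi n"
proof -
  obtain k where "m = n + 4 * k"
    using assms by (metis cong_iff_lin cong_sym mult.commute)
  moreover have "\<i> powi (4 * k) = 1"
    by (simp add: power_int_mult)
  ultimately show ?thesis by (simp add: power_int_add)
qed

lemma odd_square_mod_4: "odd (x::int) \<Longrightarrow> [x * x = 1] (mod 4)"
  by (elim oddE) (simp add: cong_iff_dvd_diff algebra_simps)

lemma moebius_Im_pos:
  fixes a b c d :: int
  assumes det: "a * d - b * c = 1" and z: "Im z > 0"
  shows "Im ((of_int a * z + of_int b) / (of_int c * z + of_int d)) > 0"
    and "of_int c * z + of_int d \<noteq> 0"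
proof -
  have *: "real_of_int a * of_int d - of_int b * of_int c = 1"
    using det by (metis of_int_1 of_int_diff of_int_mult)
  show nz: "of_int c * z + of_int d \<noteq> 0"
  proof
    assume "of_int c * z + of_int d = 0"
    then have "c = 0 \<and> d = 0" using z by (auto simp: complex_eq_iff)
    then show False using det by simp
  qed
  have "Im (of_int a * z + of_int b) * Re (of_int c * z + of_int d)
      - Re (of_int a * z + of_int b) * Im (of_int c * z + of_int d)
      = (real_of_int a * of_int d - of_int b * of_int c) * Im z"
    by (simp add: algebra_simps)
  then have num: "Im (of_int a * z + of_int b) * Re (of_int c * z + of_int d)
      - Re (of_int a * z + of_int b) * Im (of_int c * z + of_int d) = Im z"
    by (simp add: *)
  have "(Re (of_int c * z + of_int d))\<^sup>2 + (Im (of_int c * z + of_int d))\<^sup>2 > 0"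
    using nz by (simp only: sum_power2_gt_zero_iff complex_eq_iff) auto
  then show "Im ((of_int a * z + of_int b) / (of_int c * z + of_int d)) > 0"
    using z by (simp only: Im_divide num zero_less_divide_iff) auto
qed

section \<open>The explicit multiplier and its Euclidean descent\<close>

definition theta_sq_orbit :: "int \<Rightarrow> int \<Rightarrow> complex \<Rightarrow> complex" where
  "theta_sq_orbit c d = (if even c then theta2_sq else if even d then theta4_sq else theta3_sq)"

text \<open>An exponent of \<open>\<i>\<close>, relevant only modulo 4. It is 0 at the identity and
  -1 at the matrix of \<open>\<tau> \<mapsto> - 1 / \<tau>\<close>, in agreement with
  \<open>theta_sq_inversion\<close>.\<close>

definition theta2_sq_exponent :: "int \<Rightarrow> int \<Rightarrow> int \<Rightarrow> int \<Rightarrow> int" where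
  "theta2_sq_exponent a b c d = (if even c then b * d + d - 1 else a * c + c - 2)"

definition theta2_sq_transforms :: "int \<Rightarrow> int \<Rightarrow> int \<Rightarrow> int \<Rightarrow> bool" where
  "theta2_sq_transforms a b c d \<longleftrightarrow> (\<forall>\<tau>. Im \<tau> > 0 \<longrightarrow>
     theta2_sq ((of_int a * \<tau> + of_int b) / (of_int c * \<tau> + of_int d)) =
     \<i> powi theta2_sq_exponent a b c d * (of_int c * \<tau> + of_int d) * theta_sq_orbit c d \<tau>)"

text \<open>Right multiplication by the translation matrix. For even \<open>c\<close> the exponent
  grows by 1 modulo 4, matching the factor \<open>\<i>\<close> of \<open>theta2_sq\<close>. For odd
  \<open>c\<close> it involves neither \<open>b\<close> nor \<open>d\<close>, and
  \<open>theta3_sq\<close> and \<open>theta4_sq\<close> are swapped as the parity of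
  \<open>d\<close> changes.\<close>

lemma theta2_sq_transforms_shift1:
  assumes det: "a * d - b * c = 1"
  shows "theta2_sq_transforms a (b + a) c (d + c) \<longleftrightarrow> theta2_sq_transforms a b c d"
proof -
  have *: "\<i> powi theta2_sq_exponent a (b + a) c (d + c) * theta_sq_orbit c (d + c) \<tau> =
      \<i> powi theta2_sq_exponent a b c d * theta_sq_orbit c d (\<tau> + 1)" for \<tau>
  proof (cases "even c")
    case True
    have "odd (a * d - b * c)" using det by simp
    then have "odd a" using True by auto
    then obtain m where m: "a = 2 * m + 1" by (elim oddE)
    obtain l where l: "c = 2 * l" using True by (elim evenE)
    \<comment> \<open>The determinant makes the bracket vanish; \<open>a\<close> odd and
      \<open>c\<close> even make the last summand a multiple of 4.\<close>
    have "(b + a) * (d + c) + (d + c) - 1 = b * d + d - 1 + 1 + (a * d - b * c - 1) + c * (a + 2 * b + 1)"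
      by (simp add: algebra_simps)
    also have "\<dots> = b * d + d - 1 + 1 + 4 * (l * (m + b + 1))"
      using det by (simp add: m l algebra_simps)
    finally have "(b + a) * (d + c) + (d + c) - 1 - (b * d + d - 1 + 1) = 4 * (l * (m + b + 1))"
      by linarith
    then have "[(b + a) * (d + c) + (d + c) - 1 = b * d + d - 1 + 1] (mod 4)"
      by (simp only: cong_iff_dvd_diff dvd_triv_left)
    then have "\<i> powi ((b + a) * (d + c) + (d + c) - 1) = \<i> powi (b * d + d - 1 + 1)"
      by (rule imaginary_powi_cong)
    also have "\<dots> = \<i> powi (b * d + d - 1) * \<i>"
      by (subst power_int_add) simp_all
    finally show ?thesis
      using True by (simp add: theta2_sq_exponent_def theta_sq_orbit_def theta_sq_plus_1)
  next
    case False
    then show ?thesis by (auto simp: theta2_sq_exponent_def theta_sq_orbit_def theta_sq_plus_1)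
  qed
  have "theta2_sq_transforms a (b + a) c (d + c) \<longleftrightarrow> (\<forall>\<tau>. Im \<tau> > 0 \<longrightarrow>
     theta2_sq ((of_int a * (\<tau> + 1) + of_int b) / (of_int c * (\<tau> + 1) + of_int d)) =
     \<i> powi theta2_sq_exponent a b c d * (of_int c * (\<tau> + 1) + of_int d) * theta_sq_orbit c d (\<tau> + 1))"
    unfolding theta2_sq_transforms_def
  proof (intro all_cong1 imp_cong refl)
    fix \<tau> :: complex
    have "of_int a * \<tau> + of_int (b + a) = of_int a * (\<tau> + 1) + of_int b"
      "of_int c * \<tau> + of_int (d + c) = of_int c * (\<tau> + 1) + of_int d"
      by (simp_all add: algebra_simps)
    then show "(theta2_sq ((of_int a * \<tau> + of_int (b + a)) / (of_int c * \<tau> + of_int (d + c))) =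
        \<i> powi theta2_sq_exponent a (b + a) c (d + c) * (of_int c * \<tau> + of_int (d + c)) * theta_sq_orbit c (d + c) \<tau>) \<longleftrightarrow>
      (theta2_sq ((of_int a * (\<tau> + 1) + of_int b) / (of_int c * (\<tau> + 1) + of_int d)) =
        \<i> powi theta2_sq_exponent a b c d * (of_int c * (\<tau> + 1) + of_int d) * theta_sq_orbit c d (\<tau> + 1))"
      using *[of \<tau>] by (simp only: mult.assoc mult.left_commute[of _ "of_int c * (\<tau> + 1) + of_int d"])
  qed
  also have "\<dots> \<longleftrightarrow> theta2_sq_transforms a b c d"
    unfolding theta2_sq_transforms_def
  proof safe
    fix \<tau> :: complex
    assume "\<forall>\<tau>. Im \<tau> > 0 \<longrightarrow>
     theta2_sq ((of_int a * (\<tau> + 1) + of_int b) / (of_int c * (\<tau> + 1) + of_int d)) =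
     \<i> powi theta2_sq_exponent a b c d * (of_int c * (\<tau> + 1) + of_int d) * theta_sq_orbit c d (\<tau> + 1)"
      and "Im \<tau> > 0"
    then show "theta2_sq ((of_int a * \<tau> + of_int b) / (of_int c * \<tau> + of_int d)) =
     \<i> powi theta2_sq_exponent a b c d * (of_int c * \<tau> + of_int d) * theta_sq_orbit c d \<tau>"
      by (elim allE[of _ "\<tau> - 1"]) simp
  next
    fix \<tau> :: complex
    assume "\<forall>\<tau>. Im \<tau> > 0 \<longrightarrow> theta2_sq ((of_int a * \<tau> + of_int b) / (of_int c * \<tau> + of_int d)) =
     \<i> powi theta2_sq_exponent a b c d * (of_int c * \<tau> + of_int d) * theta_sq_orbit c d \<tau>"
      and "Im \<tau> > 0"
    then show "theta2_sq ((of_int a * (\<tau> + 1) + of_int b) / (of_int c * (\<tau> + 1) + of_int d)) =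
     \<i> powi theta2_sq_exponent a b c d * (of_int c * (\<tau> + 1) + of_int d) * theta_sq_orbit c d (\<tau> + 1)"
      by (elim allE[of _ "\<tau> + 1"]) simp
  qed
  finally show ?thesis .
qed

lemma theta2_sq_transforms_shift:
  assumes det: "a * d - b * c = 1"
  shows "theta2_sq_transforms a (b + n * a) c (d + n * c) \<longleftrightarrow> theta2_sq_transforms a b c d"
proof (induction n rule: int_induct[where k = 0])
  case (step1 i)
  have "a * (d + i * c) - (b + i * a) * c = 1" using det by (simp add: algebra_simps)
  from theta2_sq_transforms_shift1[OF this] step1 show ?case by (simp add: algebra_simps)
next
  case (step2 i)
  have "a * (d + (i - 1) * c) - (b + (i - 1) * a) * c = 1" using det by (simp add: algebra_simps)
  from theta2_sq_transforms_shift1[OF this] step2 show ?case by (simp add: algebra_simps)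
qed simp

text \<open>The premise concerns the matrix times that of
  \<open>\<tau> \<mapsto> - 1 / \<tau>\<close>, evaluated at \<open>- 1 / \<tau>\<close>. Exchanging
  the parities of \<open>c\<close> and \<open>d\<close> matches the exchange of
  \<open>theta2_sq\<close> and \<open>theta4_sq\<close> under inversion.\<close>

lemma theta2_sq_transforms_inversion:
  assumes det: "a * d - b * c = 1" and tr: "theta2_sq_transforms b (- a) d (- c)"
  shows "theta2_sq_transforms a b c d"
  unfolding theta2_sq_transforms_def
proof (intro allI impI)
  fix \<tau> :: complex assume \<tau>: "Im \<tau> > 0"
  then have \<tau>0: "\<tau> \<noteq> 0" by auto
  have nz: "of_int c * \<tau> + of_int d \<noteq> 0" using moebius_Im_pos(2)[OF det \<tau>] .
  have "odd (a * d - b * c)" using det by simp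
  then have odd_cd: "odd c \<or> odd d" by auto
  have cong: "[theta2_sq_exponent b (- a) d (- c) + 1 = theta2_sq_exponent a b c d] (mod 4)"
  proof (cases "odd c \<and> odd d")
    case True
    have c2: "[c * c = 1] (mod 4)" and d2: "[d * d = 1] (mod 4)"
      using True odd_square_mod_4 by auto
    obtain m n where mn: "c = 2 * m + 1" "d = 2 * n + 1" using True by (auto elim!: oddE)
    have "4 dvd d * d - 1" "4 dvd c * c - 1"
      using c2 d2 by (simp_all add: cong_iff_dvd_diff)
    then obtain k l where kl: "d * d = 4 * k + 1" "c * c = 4 * l + 1"
      by (metis dvdE diff_add_cancel)
    have ad: "a * d = 1 + b * c" using det by simp
    \<comment> \<open>Multiplication by the unit \<open>d\<close> modulo 4 makes
      \<open>b * d\<close> and \<open>a * c\<close> comparable: the determinant rewrites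
      \<open>a * d\<close>, odd squares become 1, and \<open>(1 - c) * (1 + d)\<close>, a product of
      even numbers, is left.\<close>
    have "d * (b * d + d - 1 - (a * c + c - 2)) = (b + 1) * (d * d) + d - c * (a * d) - c * d"
      by (simp add: algebra_simps)
    also have "\<dots> = (b + 1) * (4 * k + 1) + d - c - b * (c * c) - c * d"
      unfolding ad kl(1) by (simp add: algebra_simps)
    also have "\<dots> = 4 * ((b + 1) * k - b * l) + (1 - c) * (1 + d)"
      unfolding kl(2) by (simp add: algebra_simps)
    also have "\<dots> = 4 * ((b + 1) * k - b * l - m * (n + 1))"
      by (simp add: mn algebra_simps)
    finally have "4 dvd d * (b * d + d - 1 - (a * c + c - 2))" by simp
    moreover have "coprime 4 d"
      using True coprime_power_left_iff[of 2 2 d] by simp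
    ultimately have "4 dvd b * d + d - 1 - (a * c + c - 2)"
      by (simp add: coprime_dvd_mult_right_iff)
    then show ?thesis using True by (simp add: theta2_sq_exponent_def cong_iff_dvd_diff)
  next
    case False
    then consider "even c" "odd d" | "odd c" "even d"
      using odd_cd by blast
    then show ?thesis
    proof cases
      case 1
      then show ?thesis by (simp add: theta2_sq_exponent_def)
    next
      case 2
      then show ?thesis
        by (auto elim!: oddE simp: theta2_sq_exponent_def cong_iff_dvd_diff)
    qed
  qed
  have orb: "theta_sq_orbit d (- c) (- 1 / \<tau>) = - \<i> * \<tau> * theta_sq_orbit c d \<tau>"
  proof -
    show ?thesis
      using theta_sq_inversion[OF \<tau>] odd_cd by (auto simp: theta_sq_orbit_def)
  qed
  have "(of_int a * \<tau> + of_int b) / (of_int c * \<tau> + of_int d) =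
      (- \<tau> * (of_int b * (- 1 / \<tau>) + of_int (- a))) / (- \<tau> * (of_int d * (- 1 / \<tau>) + of_int (- c)))"
    using \<tau>0 by (simp add: algebra_simps)
  also have "\<dots> = (of_int b * (- 1 / \<tau>) + of_int (- a)) / (of_int d * (- 1 / \<tau>) + of_int (- c))"
    using \<tau>0 by (intro mult_divide_mult_cancel_left) simp
  finally have arg: "(of_int a * \<tau> + of_int b) / (of_int c * \<tau> + of_int d) =
      (of_int b * (- 1 / \<tau>) + of_int (- a)) / (of_int d * (- 1 / \<tau>) + of_int (- c))" .
  have "theta2_sq ((of_int a * \<tau> + of_int b) / (of_int c * \<tau> + of_int d)) =
      \<i> powi theta2_sq_exponent b (- a) d (- c) * (of_int d * (- 1 / \<tau>) + of_int (- c)) * theta_sq_orbit d (- c) (- 1 / \<tau>)"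
    unfolding arg by (rule tr[unfolded theta2_sq_transforms_def, rule_format, OF Im_neg_inverse[OF \<tau>]])
  \<comment> \<open>The factor \<open>- \<i> * \<tau>\<close> is split: \<open>\<i>\<close> raises
    the exponent by 1, and \<open>- \<tau>\<close> restores the denominator.\<close>
  also have "\<dots> = (\<i> powi theta2_sq_exponent b (- a) d (- c) * \<i>) *
      (- \<tau> * (of_int d * (- 1 / \<tau>) + of_int (- c))) * theta_sq_orbit c d \<tau>"
    unfolding orb by (simp add: mult_ac)
  also have "- \<tau> * (of_int d * (- 1 / \<tau>) + of_int (- c)) = of_int c * \<tau> + of_int d"
    using \<tau>0 by (simp add: algebra_simps)
  also have "\<i> powi theta2_sq_exponent b (- a) d (- c) * \<i> = \<i> powi (theta2_sq_exponent b (- a) d (- c) + 1)"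
    by (simp add: power_int_add)
  also have "\<dots> = \<i> powi theta2_sq_exponent a b c d"
    by (rule imaginary_powi_cong[OF cong])
  finally show "theta2_sq ((of_int a * \<tau> + of_int b) / (of_int c * \<tau> + of_int d)) =
      \<i> powi theta2_sq_exponent a b c d * (of_int c * \<tau> + of_int d) * theta_sq_orbit c d \<tau>" .
qed

text \<open>Translation reduces \<open>d\<close> to \<open>d mod c\<close>, and inversion moves this
  remainder into the place of \<open>c\<close>. At \<open>c = 0\<close> the matrix is a translation
  up to sign.\<close>

lemma theta2_sq_transforms:
  assumes "a * d - b * c = 1"
  shows "theta2_sq_transforms a b c d"
  using assms
proof (induction "nat \<bar>c\<bar>" arbitrary: a b c d rule: less_induct)
  case less
  note det = \<open>a * d - b * c = 1\<close>
  show ?case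
  proof (cases "c = 0")
    case True
    have ad: "a = 1 \<and> d = 1 \<or> a = - 1 \<and> d = - 1"
      using det True by (simp add: zmult_eq_1_iff)
    \<comment> \<open>For \<open>a = d = - 1\<close> the exponent is -2, and the resulting sign
      cancels that of \<open>d\<close>.\<close>
    have "theta2_sq_transforms a 0 0 d"
      using ad by (auto simp: theta2_sq_transforms_def theta2_sq_exponent_def theta_sq_orbit_def power_int_minus)
    \<comment> \<open>Since \<open>a * a = 1\<close>, this shift clears the upper right
      entry.\<close>
    then have "theta2_sq_transforms a (b + (- a * b) * a) c (d + (- a * b) * c)"
      using ad True by auto
    then show ?thesis by (simp only: theta2_sq_transforms_shift[OF det])
  next
    case False
    define n where "n = d div c"
    have r: "d + (- n) * c = d mod c"
      by (simp add: n_def minus_div_mult_eq_mod)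
    have lt: "nat \<bar>d + (- n) * c\<bar> < nat \<bar>c\<bar>"
      unfolding r using False abs_mod_less by simp
    have det': "a * (d + (- n) * c) - (b + (- n) * a) * c = 1"
      using det by (simp add: algebra_simps)
    have "theta2_sq_transforms (b + (- n) * a) (- a) (d + (- n) * c) (- c)"
      by (rule less.hyps[OF lt]) (use det' in \<open>simp add: algebra_simps\<close>)
    then have "theta2_sq_transforms a (b + (- n) * a) c (d + (- n) * c)"
      by (rule theta2_sq_transforms_inversion[OF det'])
    then show ?thesis by (simp only: theta2_sq_transforms_shift[OF det])
  qed
qed

lemmas theta2_sq_moebius = theta2_sq_transforms[unfolded theta2_sq_transforms_def, rule_format]

subsection \<open>The eta quotient\<close>

lemma norm_ee_Im_0: "Im z = 0 \<Longrightarrow> norm (ee z) = 1"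
  by (simp add: ee_def)

lemma holomorphic_ball_scaled_power:
  assumes G: "G holomorphic_on ball 0 1" and \<zeta>: "norm \<zeta> = 1" and m: "m > 0"
  shows "(\<lambda>t. G (\<zeta> * t ^ m)) holomorphic_on ball 0 1"
proof -
  have "(G \<circ> (\<lambda>t. \<zeta> * t ^ m)) holomorphic_on ball 0 1"
  proof (rule holomorphic_on_compose_gen[OF _ G])
    show "(\<lambda>t. \<zeta> * t ^ m) ` ball 0 1 \<subseteq> ball 0 1"
      using \<zeta> m by (auto simp: norm_mult norm_power power_less_one_iff)
  qed (intro holomorphic_intros)
  then show ?thesis by (simp add: o_def)
qed

text \<open>The theta squares as functions of the local parameter at infinity, holomorphic on the
  whole unit disc including the cusp at 0.\<close>

definition theta2_sq_series :: "complex \<Rightarrow> complex" where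
  "theta2_sq_series y = 4 * y * qpoch (y ^ 4) (y ^ 4) ^ 2 * qpoch (- (y ^ 4)) (y ^ 4) ^ 4"

definition theta3_sq_series :: "complex \<Rightarrow> complex" where
  "theta3_sq_series x = qpoch (x\<^sup>2) (x\<^sup>2) ^ 2 * qpoch (- x) (x\<^sup>2) ^ 4"

lemma holomorphic_theta_sq_series:
  "theta2_sq_series holomorphic_on ball 0 1"
  "theta3_sq_series holomorphic_on ball 0 1"
  unfolding theta2_sq_series_def theta3_sq_series_def
  by (intro holomorphic_intros; simp add: norm_power power_less_one_iff)+

lemma theta_sq_conv_series:
  "theta2_sq \<tau> = theta2_sq_series (ee (\<tau> / 4))"
  "theta3_sq \<tau> = theta3_sq_series (ee (\<tau> / 2))"
  "theta4_sq \<tau> = theta3_sq_series (- ee (\<tau> / 2))"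
  by (simp_all add: theta2_sq_def theta2_sq_series_def theta3_sq_def theta4_sq_def
      theta3_sq_series_def ee_power)

lemma dedekind_eta_conv_qpoch: "dedekind_eta z = ee (z / 24) * qpoch (ee z) (ee z)"
  by (simp add: dedekind_eta_def qpoch_def ee_def)

text \<open>With \<open>q = ee (4 * z)\<close>, the numerator contains
  \<open>qpoch (q\<^sup>2) (q\<^sup>2)\<close>, which is \<open>qpoch q q * qpoch (- q) q\<close>;
  two of the four factors \<open>qpoch q q\<close> cancel against the denominator.\<close>

lemma eta_quotient_conv_theta2_sq:
  assumes "Im z > 0"
  shows "dedekind_eta (8 * z) ^ 4 / dedekind_eta (4 * z) ^ 2 = theta2_sq (4 * z) / 4"
proof -
  let ?q = "ee (4 * z)"
  have q: "norm ?q < 1" using assms by simp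
  have q2: "ee (8 * z) = ?q\<^sup>2" by (simp add: ee_power)
  have e: "ee (z / 3) ^ 4 = ee z * ee (z / 6) ^ 2"
  proof -
    have "4 * (z / 3) = z + 2 * (z / 6)" by simp
    then show ?thesis unfolding ee_power by (simp only: of_nat_numeral ee_add)
  qed
  have "dedekind_eta (8 * z) ^ 4 = ee z * ee (z / 6) ^ 2 * (qpoch ?q ?q * qpoch (- ?q) ?q) ^ 4"
    unfolding dedekind_eta_conv_qpoch power_mult_distrib[of "ee _"] q2 qpoch_mult_minus[OF q]
    by (simp add: e)
  moreover have "dedekind_eta (4 * z) ^ 2 = ee (z / 6) ^ 2 * qpoch ?q ?q ^ 2"
    by (simp add: dedekind_eta_conv_qpoch power_mult_distrib)
  ultimately show ?thesis
    using qpoch_self_nonzero[OF q]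
    by (simp add: theta2_sq_def power2_eq_square power4_eq_xxxx)
qed

section \<open>The character and the expansions at the cusps\<close>

text \<open>Conjugation by \<open>z \<mapsto> 4 * z\<close> gives the matrix
  \<open>(a, 4 b; c / 4, d)\<close>. Its lower left entry is even because 8 divides
  \<open>c\<close>, so \<open>theta2_sq\<close> is kept, and the exponent is \<open>d - 1\<close>
  modulo 4.\<close>

lemma theta2_sq_4_Gamma0_8:
  assumes det: "a * d - b * c = 1" and c: "8 dvd c" and z: "Im z > 0"
  shows "theta2_sq (4 * ((of_int a * z + of_int b) / (of_int c * z + of_int d))) =
    chi 1 d * (of_int c * z + of_int d) * theta2_sq (4 * z)"
proof -
  obtain m where m: "c = 8 * m" using c by (elim dvdE)
  have "odd (a * d - b * c)" using det by simp
  then have d: "odd d" using m by auto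
  have det': "a * d - (4 * b) * (2 * m) = 1" using det by (simp add: m)
  have chi: "\<i> powi theta2_sq_exponent a (4 * b) (2 * m) d = chi 1 d"
  proof -
    have "d mod 4 = 1 \<or> d mod 4 = 3" using d by presburger
    then show ?thesis
    proof
      assume "d mod 4 = 1"
      then have "[4 * x + d - 1 = 0] (mod 4)" "[d = 1] (mod 4)" for x
        unfolding cong_def by presburger+
      from this(1)[of "b * d"] this(2)
      have "[4 * b * d + d - 1 = 0] (mod 4)" "[d = 1] (mod 4)"
        by (simp_all only: mult.assoc not_False_eq_True)
      then show ?thesis using d imaginary_powi_cong
        by (fastforce simp: theta2_sq_exponent_def chi_def)
    next
      assume "d mod 4 = 3"
      then have "[4 * x + d - 1 = 2] (mod 4)" "\<not> [d = 1] (mod 4)" for x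
        unfolding cong_def by presburger+
      from this(1)[of "b * d"] this(2)
      have "[4 * b * d + d - 1 = 2] (mod 4)" "\<not> [d = 1] (mod 4)"
        by (simp_all only: mult.assoc not_False_eq_True)
      then show ?thesis using d imaginary_powi_cong
        by (fastforce simp: theta2_sq_exponent_def chi_def)
    qed
  qed
  have "4 * ((of_int a * z + of_int b) / (of_int c * z + of_int d)) =
      (of_int a * (4 * z) + of_int (4 * b)) / (of_int (2 * m) * (4 * z) + of_int d)"
    by (simp add: m algebra_simps)
  moreover have "theta2_sq ((of_int a * (4 * z) + of_int (4 * b)) / (of_int (2 * m) * (4 * z) + of_int d)) =
      chi 1 d * (of_int (2 * m) * (4 * z) + of_int d) * theta2_sq (4 * z)"
    using theta2_sq_moebius[OF det', of "4 * z"] z unfolding chi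
    by (simp add: theta_sq_orbit_def)
  ultimately show ?thesis by (simp add: m)
qed

text \<open>
  The substitution \<open>z \<mapsto> 4 z\<close> composed with the matrix \<open>(a, b; c, d)\<close> equals a matrix of determinant 1
  composed with \<open>(p, r; 0, s)\<close>, where \<open>p = gcd (4 a) c\<close> and \<open>p s = 4\<close>. If \<open>s = 4\<close>, then \<open>c\<close> is odd, so
  that the series in \<open>ee (\<tau> / 2)\<close> occur and the width 8 suffices.
\<close>

lemma theta2_sq_4_expansion:
  assumes det: "a * d - b * c = 1"
  obtains G where "G holomorphic_on ball 0 1"
    and "\<And>z. Im z > 0 \<Longrightarrow> theta2_sq (4 * ((of_int a * z + of_int b) / (of_int c * z + of_int d))) =
      (of_int c * z + of_int d) * G (ee (z / 8))"
proof -
  define p where "p = gcd (4 * a) c"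
  have "p dvd 4 * a * d - 4 * b * c"
    unfolding p_def by (intro dvd_diff dvd_mult2 dvd_mult gcd_dvd1 gcd_dvd2)
  also have "4 * a * d - 4 * b * c = 4" using det by simp
  finally have p4: "p dvd 4" .
  then obtain s where ps: "4 = p * s" by (elim dvdE)
  have "p \<ge> 0" "p \<noteq> 0" using p4 by (auto simp: p_def)
  then have p: "p > 0" by simp
  have "p \<le> 4" using zdvd_imp_le[OF p4] by simp
  then have "p \<in> {1, 2, 3, 4}" using p by auto
  moreover have "p \<noteq> 3"
  proof
    assume "p = 3"
    then have "4 = 3 * s" using ps by simp
    then show False by presburger
  qed
  ultimately have cases: "p = 1 \<and> s = 4 \<or> p = 2 \<and> s = 2 \<or> p = 4 \<and> s = 1" using ps by auto
  then have s: "s > 0" by auto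
  obtain a' where a': "4 * a = p * a'" using gcd_dvd1[of "4 * a" c] by (metis p_def dvdE)
  obtain c' where c': "c = p * c'" using gcd_dvd2[of "4 * a" c] by (metis p_def dvdE)
  \<comment> \<open>Bezout coefficients complete the column \<open>(a', c')\<close> to a matrix of
    determinant 1.\<close>
  obtain y x where yx: "y * (4 * a) + x * c = p" using bezout_int[of "4 * a" c] by (auto simp: p_def)
  have "p * (a' * y - (- x) * c') = y * (p * a') + x * (p * c')" by (simp add: algebra_simps)
  also have "\<dots> = p * 1" by (simp only: a'[symmetric] c'[symmetric] yx mult_1_right)
  finally have det': "a' * y - (- x) * c' = 1" using p by simp
  \<comment> \<open>The upper right entry of the inverse of that matrix times
    \<open>(4 a, 4 b; c, d)\<close>.\<close>
  define r where "r = 4 * b * y + x * d"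
  have R: "a' * r - x * s = 4 * b" "c' * r + y * s = d"
  proof -
    have "p * (a' * r - x * s) = (p * a') * r - x * (p * s)"
      by (simp add: algebra_simps)
    also have "\<dots> = (4 * a) * r - x * 4"
      by (simp only: a'[symmetric] ps[symmetric])
    also have "\<dots> = 4 * b * (4 * a * y) + 4 * x * (a * d - 1)"
      by (simp add: r_def algebra_simps)
    also have "a * d - 1 = b * c" using det by simp
    also have "4 * b * (4 * a * y) + 4 * x * (b * c) = 4 * b * (y * (4 * a) + x * c)"
      by (simp add: algebra_simps)
    finally show "a' * r - x * s = 4 * b" unfolding yx using p by simp
    have "p * (c' * r + y * s) = (p * c') * r + y * (p * s)"
      by (simp add: algebra_simps)
    also have "\<dots> = c * r + y * 4"
      by (simp only: c'[symmetric] ps[symmetric])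
    also have "\<dots> = 4 * y * (1 + b * c) + x * c * d"
      by (simp add: r_def algebra_simps)
    also have "1 + b * c = a * d" using det by simp
    also have "4 * y * (a * d) + x * c * d = (y * (4 * a) + x * c) * d"
      by (simp add: algebra_simps)
    finally show "c' * r + y * s = d" unfolding yx using p by simp
  qed
  define \<sigma> where "\<sigma> = (\<lambda>z. (of_int p * z + of_int r) / of_int s :: complex)"
  have Im\<sigma>: "Im (\<sigma> z) > 0" if "Im z > 0" for z
  proof -
    have "\<sigma> z = of_real (1 / of_int s) * (of_int p * z + of_int r)" by (simp add: \<sigma>_def)
    then show ?thesis using that p s by simp
  qed
  \<comment> \<open>The division by \<open>s\<close> is there because
    \<open>c' * \<sigma> z + y\<close> equals \<open>(c * z + d) / s\<close>.\<close>
  define K where "K = \<i> powi theta2_sq_exponent a' (- x) c' y / of_int s"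
  have sC: "(of_int s :: complex) \<noteq> 0" using s by simp
  have main: "theta2_sq (4 * ((of_int a * z + of_int b) / (of_int c * z + of_int d))) =
      (of_int c * z + of_int d) * (K * theta_sq_orbit c' y (\<sigma> z))" if z: "Im z > 0" for z
  proof -
    have \<sigma>s: "\<sigma> z * of_int s = of_int p * z + of_int r"
      using sC by (simp add: \<sigma>_def)
    have num: "(of_int a' * \<sigma> z + of_int (- x)) * of_int s = 4 * (of_int a * z + of_int b)"
    proof -
      have "(of_int a' * \<sigma> z + of_int (- x)) * of_int s =
          of_int a' * (\<sigma> z * of_int s) - of_int (x * s)"
        by (simp add: algebra_simps)
      also have "\<dots> = of_int (p * a') * z + of_int (a' * r - x * s)"
        unfolding \<sigma>s by (simp add: algebra_simps)
      also have "\<dots> = 4 * (of_int a * z + of_int b)"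
        unfolding a'[symmetric] R by (simp add: algebra_simps)
      finally show ?thesis .
    qed
    have den: "(of_int c' * \<sigma> z + of_int y) * of_int s = of_int c * z + of_int d"
    proof -
      have "(of_int c' * \<sigma> z + of_int y) * of_int s = of_int c' * (\<sigma> z * of_int s) + of_int (y * s)"
        by (simp add: algebra_simps)
      also have "\<dots> = of_int (p * c') * z + of_int (c' * r + y * s)"
        unfolding \<sigma>s by (simp add: algebra_simps)
      finally have "(of_int c' * \<sigma> z + of_int y) * of_int s =
          of_int (p * c') * z + of_int (c' * r + y * s)" .
      then show ?thesis by (simp only: c'[symmetric] R)
    qed
    have arg: "4 * ((of_int a * z + of_int b) / (of_int c * z + of_int d)) =
        (of_int a' * \<sigma> z + of_int (- x)) / (of_int c' * \<sigma> z + of_int y)"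
      unfolding times_divide_eq_right num[symmetric] den[symmetric]
      by (rule mult_divide_mult_cancel_right[OF sC])
    have "theta2_sq (4 * ((of_int a * z + of_int b) / (of_int c * z + of_int d))) =
        \<i> powi theta2_sq_exponent a' (- x) c' y * (of_int c' * \<sigma> z + of_int y) * theta_sq_orbit c' y (\<sigma> z)"
      unfolding arg by (rule theta2_sq_moebius[OF det' Im\<sigma>[OF z]])
    also have "\<dots> = (of_int c' * \<sigma> z + of_int y) * of_int s * (K * theta_sq_orbit c' y (\<sigma> z))"
      using sC by (simp add: K_def)
    finally show ?thesis unfolding den .
  qed
  have norm_ee_r: "norm (ee (of_int r / (of_int h * of_int s))) = 1" for h
  proof -
    have "complex_of_int r / (of_int h * of_int s) = of_real (of_int r / (of_int h * of_int s))" by simp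
    then show ?thesis by (simp only: norm_ee_Im_0 Im_complex_of_real)
  qed
  \<comment> \<open>A series in \<open>ee (\<tau> / h)\<close> becomes one in
    \<open>ee (z / 8)\<close> when \<open>8 * p / (h * s)\<close> is a natural number
    \<open>m\<close>; \<open>r\<close> only contributes a root of unity.\<close>
  have ee_\<sigma>: "ee (\<sigma> z / of_int h) = ee (of_int r / (of_int h * of_int s)) * ee (z / 8) ^ m"
    if "8 * p = h * (int m * s)" for h z and m :: nat
  proof -
    have h: "(of_int h :: complex) \<noteq> 0" using that p by auto
    have *: "8 * complex_of_int p = of_int h * (of_nat m * of_int s)"
      using that by (metis of_int_mult of_int_numeral of_int_of_nat_eq)
    have P: "complex_of_int p = of_int h * (of_nat m * of_int s) / 8"
      unfolding *[symmetric] by simp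
    have "\<sigma> z / of_int h = of_int r / (of_int h * of_int s) + of_nat m * (z / 8)"
      using h sC by (simp add: \<sigma>_def P field_simps)
    then show ?thesis by (simp only: ee_power ee_add)
  qed
  show thesis
  proof (cases "even c'")
    case True
    \<comment> \<open>Here \<open>h = 4\<close>, and \<open>p = 1\<close>, \<open>s = 4\<close> is
      the one case in which \<open>m = 2 * p / s\<close> is not an integer.\<close>
    have "p \<noteq> 1"
    proof
      assume "p = 1"
      moreover from this have "2 dvd gcd (4 * a) c" using True c' by auto
      ultimately show False by (simp add: p_def)
    qed
    then obtain m :: nat where m: "m > 0" "8 * p = 4 * (int m * s)"
      using cases that[of 2] that[of 8] by auto
    show thesis
    proof (rule that)
      show "(\<lambda>t. K * theta2_sq_series (ee (of_int r / (of_int 4 * of_int s)) * t ^ m)) holomorphic_on ball 0 1"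
        by (intro holomorphic_intros holomorphic_ball_scaled_power holomorphic_theta_sq_series m norm_ee_r)
    qed (use True main ee_\<sigma>[OF m(2)] in \<open>simp add: theta_sq_orbit_def theta_sq_conv_series\<close>)
  next
    case False
    \<comment> \<open>Here \<open>h = 2\<close>, so \<open>m = 4 * p / s\<close> is 1, 4 or
      16.\<close>
    obtain m :: nat where m: "m > 0" "8 * p = 2 * (int m * s)"
      using cases that[of 1] that[of 4] that[of 16] by auto
    define \<epsilon> :: complex where "\<epsilon> = (if even y then - 1 else 1)"
    show thesis
    proof (rule that)
      show "(\<lambda>t. K * theta3_sq_series (\<epsilon> * ee (of_int r / (of_int 2 * of_int s)) * t ^ m)) holomorphic_on ball 0 1"
        by (intro holomorphic_intros holomorphic_ball_scaled_power holomorphic_theta_sq_series m)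
           (simp add: \<epsilon>_def norm_mult norm_ee_r[of 2, simplified])
    qed (use False main ee_\<sigma>[OF m(2)] in
        \<open>auto simp: theta_sq_orbit_def theta_sq_conv_series \<epsilon>_def\<close>)
  qed
qed

section \<open>From weight 1 to weight \<open>k\<close>\<close>

text \<open>At even \<open>d\<close> and \<open>k = 0\<close> the character is 0 while the power is
  1, hence the restriction to odd \<open>d\<close>.\<close>

lemma chi_eq_power: "odd d \<Longrightarrow> chi k d = chi 1 d ^ k"
  by (simp add: chi_def)

text \<open>Reduces weight \<open>k\<close> to weight 1. Here \<open>w\<close> stands for a
  character value times \<open>g z\<close>, or for the value of a power series at a cusp.\<close>

lemma slash_power:
  fixes A :: "int ^ 2 ^ 2"
  assumes A: "A $ 1 $ 1 = a" "A $ 1 $ 2 = b" "A $ 2 $ 1 = c" "A $ 2 $ 2 = d"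
    and det: "a * d - b * c = 1" and z: "Im z > 0"
    and f: "\<And>z. Im z > 0 \<Longrightarrow> f z = g z ^ k"
    and g: "g ((of_int a * z + of_int b) / (of_int c * z + of_int d)) = (of_int c * z + of_int d) * w"
  shows "slash (int k) f A z = w ^ k"
proof -
  have "slash (int k) f A z = inverse ((of_int c * z + of_int d) ^ k) * ((of_int c * z + of_int d) * w) ^ k"
    unfolding slash_def A f[OF moebius_Im_pos(1)[OF det z]] g by (simp add: power_int_minus)
  then show ?thesis
    using moebius_Im_pos(2)[OF det z] by (simp add: power_mult_distrib)
qed

lemma SL2Z_entries:
  fixes A :: "int ^ 2 ^ 2"
  assumes "A \<in> SL2Z"
  obtains a b c d where "A $ 1 $ 1 = a" "A $ 1 $ 2 = b" "A $ 2 $ 1 = c" "A $ 2 $ 2 = d"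
    "a * d - b * c = 1"
  by (rule that[OF refl refl refl refl]) (use assms in \<open>simp add: SL2Z_def det_2\<close>)

theorem proposition5p10:
  fixes k :: nat
  shows "(\<lambda>z. dedekind_eta (8 * z) ^ (4 * k) / dedekind_eta (4 * z) ^ (2 * k))
           \<in> modular_forms (int k) 8 (chi k)"
proof -
  define f where "f = (\<lambda>z. dedekind_eta (8 * z) ^ (4 * k) / dedekind_eta (4 * z) ^ (2 * k))"
  define g where "g = (\<lambda>z. theta2_sq (4 * z) / 4)"
  have f: "f z = g z ^ k" if "Im z > 0" for z
    by (simp only: f_def g_def power_mult power_divide[symmetric] eta_quotient_conv_theta2_sq[OF that])
  have hol: "f holomorphic_on upper_half_plane"
  proof (rule holomorphic_transform)
    \<comment> \<open>At \<open>\<tau> = 4 * z\<close> the series variable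
      \<open>ee (\<tau> / 4)\<close> is \<open>ee z\<close>.\<close>
    have "(theta2_sq_series \<circ> ee) holomorphic_on upper_half_plane"
      by (rule holomorphic_on_compose_gen[OF _ holomorphic_theta_sq_series(1)])
         (auto intro!: holomorphic_on_ee[of "\<lambda>z. z"] simp: upper_half_plane_def)
    then have "(\<lambda>z. theta2_sq (4 * z)) holomorphic_on upper_half_plane"
      by (simp add: theta_sq_conv_series o_def)
    then show "(\<lambda>z. g z ^ k) holomorphic_on upper_half_plane"
      unfolding g_def by (intro holomorphic_on_power holomorphic_on_divide holomorphic_on_const) auto
  qed (simp add: f upper_half_plane_def)
  have \<Gamma>0: "slash (int k) f A z = chi k (A $ 2 $ 2) * f z"
    if A: "A \<in> Gamma0 8" and z: "z \<in> upper_half_plane" for A z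
  proof -
    have SL: "A \<in> SL2Z" and c8: "[A $ 2 $ 1 = 0] (mod int 8)"
      using A unfolding Gamma0_def by blast+
    from SL obtain a b c d where abcd: "A $ 1 $ 1 = a" "A $ 1 $ 2 = b" "A $ 2 $ 1 = c" "A $ 2 $ 2 = d"
      and det: "a * d - b * c = 1" by (rule SL2Z_entries)
    have c: "8 dvd c" using c8 unfolding abcd by (simp add: cong_0_iff)
    have Im: "Im z > 0" using z by (simp add: upper_half_plane_def)
    have "odd (a * d - b * c)" using det by simp
    moreover have "even c" using c by (elim dvdE) simp
    ultimately have "odd d" by simp
    have "slash (int k) f A z = (chi 1 d * g z) ^ k"
    proof (rule slash_power[OF abcd det Im f])
      show "g ((of_int a * z + of_int b) / (of_int c * z + of_int d)) =
          (of_int c * z + of_int d) * (chi 1 d * g z)"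
        unfolding g_def theta2_sq_4_Gamma0_8[OF det c Im] by simp
    qed
    also have "\<dots> = chi k d * f z"
      unfolding f[OF Im] chi_eq_power[OF \<open>odd d\<close>, of k] by (rule power_mult_distrib)
    finally show ?thesis unfolding abcd .
  qed
  have \<Gamma>1: "slash (int k) f A z = f z" if A: "A \<in> Gamma1 8" and z: "z \<in> upper_half_plane" for A z
  proof -
    have "A \<in> Gamma0 8" and d8: "[A $ 2 $ 2 = 1] (mod int 8)"
      using A by (simp_all only: Gamma0_def Gamma1_def mem_Collect_eq)
    have chi: "chi k d = 1" if "[d = 1] (mod int 8)" for d
    proof -
      have "d mod 8 = 1" using that by (simp add: cong_def)
      then have "odd d" "d mod 4 = 1" by presburger+
      then show ?thesis by (simp add: chi_def cong_def)
    qed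
    show ?thesis
      unfolding \<Gamma>0[OF \<open>A \<in> Gamma0 8\<close> z] chi[OF d8] by (rule mult_1_left)
  qed
  have expansion: "\<exists>a :: nat \<Rightarrow> complex. \<forall>z \<in> upper_half_plane.
      (\<lambda>n. a n * exp (2 * of_real pi * \<i> * z / of_nat 8) ^ n) sums slash (int k) f A z"
    if A: "A \<in> SL2Z" for A
  proof -
    from A obtain a b c d where abcd: "A $ 1 $ 1 = a" "A $ 1 $ 2 = b" "A $ 2 $ 1 = c" "A $ 2 $ 2 = d"
      and det: "a * d - b * c = 1" by (rule SL2Z_entries)
    obtain G where G: "G holomorphic_on ball 0 1" and
      eq: "\<And>z. Im z > 0 \<Longrightarrow> theta2_sq (4 * ((of_int a * z + of_int b) / (of_int c * z + of_int d))) =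
        (of_int c * z + of_int d) * G (ee (z / 8))"
      by (rule theta2_sq_4_expansion[OF det]) (rule that)
    define h where "h = (\<lambda>t. (G t / 4) ^ k)"
    have h: "h holomorphic_on ball 0 1"
      unfolding h_def by (intro holomorphic_on_power holomorphic_on_divide holomorphic_on_const G) auto
    \<comment> \<open>The Taylor coefficients of \<open>h\<close> at 0 are the Fourier coefficients,
      as \<open>ee (z / 8)\<close> lies in the unit disc.\<close>
    have "(\<lambda>n. (deriv ^^ n) h 0 / fact n * exp (2 * of_real pi * \<i> * z / of_nat 8) ^ n)
        sums slash (int k) f A z" if z: "z \<in> upper_half_plane" for z
    proof -
      have Im: "Im z > 0" using z by (simp add: upper_half_plane_def)
      have "slash (int k) f A z = h (ee (z / 8))"
        unfolding h_def
      proof (rule slash_power[OF abcd det Im f])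
        show "g ((of_int a * z + of_int b) / (of_int c * z + of_int d)) =
            (of_int c * z + of_int d) * (G (ee (z / 8)) / 4)"
          unfolding g_def eq[OF Im] by (rule times_divide_eq_right[symmetric])
      qed
      moreover have "exp (2 * of_real pi * \<i> * z / of_nat 8) = ee (z / 8)"
        by (simp add: ee_def)
      moreover have "ee (z / 8) \<in> ball 0 1" using Im by simp
      ultimately show ?thesis
        using holomorphic_power_series[OF h, of "ee (z / 8)"] by (simp only: diff_zero)
    qed
    then show ?thesis by (intro exI ballI)
  qed
  have "f \<in> modular_forms_Gamma1 (int k) 8"
    unfolding modular_forms_Gamma1_def
    by (rule CollectI, intro conjI ballI hol \<Gamma>1 expansion)
  then show ?thesis
    unfolding f_def[symmetric] modular_forms_def by (intro CollectI conjI ballI \<Gamma>0)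
qed

end
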